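(* Let $\Omega\subset\mathbb{R}^d$ be a bounded Lipschitz domain, $s\in(0,1)$, $\alpha>0$, $f\in L^2(\Omega)$, and let $g\in[L^2_s(\Omega^c)]'$ be such that $$g(x)|x|^{d+2s}\to0\quad\text{as }|x|\to\infty.$$ Then the unique solution $u\in\mathbb{V}$ of $$\langle u,v\rangle_{\mathbb{X}}+\alpha(u,v)_{L^2(\Omega)}=(f,v)_{L^2(\Omega)}+(g,v)_{L^2(\Omega^c)}\qquad\forall v\in\mathbb{V}$$ satisfies $$\lim_{|x|\to\infty}u(x)=\frac{1}{|\Omega|}\int_\Omega u=\frac{1}{\alpha|\Omega|}\left(\int_\Omega f+\int_{\Omega^c}g\right).$$
   Context: $\Omega^c=\mathbb{R}^d\setminus\overline\Omega$, and $C_{d,s}=\frac{2^{2s}s\,\Gamma(s+d/2)}{\pi^{d/2}\Gamma(1-s)}$. $\langle u,v\rangle_{\mathbb{X}}=\frac{C_{d,s}}{2}\iint_{(\mathbb{R}^d\times\mathbb{R}^d)\setminus(\Omega^c\times\Omega^c)}\frac{(u(x)-u(y))(v(x)-v(y))}{|x-y|^{d+2s}}\,dx\,dy$, $|v|_{\mathbb{X}}=\langle v,v\rangle_{\mathbb{X}}^{1/2}$, $\|v\|_{\mathbb{V}}=(\|v\|_{L^2(\Omega)}^2+|v|_{\mathbb{X}}^2)^{1/2}$, and $\mathbb{V}=\{v:\mathbb{R}^d\to\mathbb{R}\text{ measurable}:\|v\|_{\mathbb{V}}<\infty\}$ (functions identified when equal a.e.). $(\cdot,\cdot)_{L^2(A)}$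 denotes the integral over $A$ of the product. $g\in[L^2_s(\Omega^c)]'$ means that $g:\Omega^c\to\mathbb{R}$ is measurable and $\int_{\Omega^c}|g(x)|^2(1+|x|^{d+2s})\,dx<\infty$. Since $u$ and $g$ are defined up to null sets, limits as $|x|\to\infty$ are understood in the essential sense: $w(x)\to\ell$ as $|x|\to\infty$ means that $\operatorname{ess\,sup}_{|x|>r}|w(x)-\ell|\to0$ as $r\to\infty$. *)

theory Defs
  imports "HOL-Analysis.Analysis" "HOL-Probability.Essential_Supremum"
begin

(* Near each boundary point the set lies on one side of the graph, in the direction e,
   of a Lipschitz function phi on the hyperplane orthogonal to e. *)
definition lipschitz_boundary :: "'a::euclidean_space set \<Rightarrow> bool" where
  "lipschitz_boundary \<Omega> \<longleftrightarrow>
    (\<forall>p\<in>frontier \<Omega>. \<exists>r>0. \<exists>e \<phi> L.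
       norm e = 1 \<and> L-lipschitz_on {y. y \<bullet> e = 0} \<phi> \<and>
       \<Omega> \<inter> ball p r = {x \<in> ball p r. \<phi> (x - (x \<bullet> e) *\<^sub>R e) < x \<bullet> e})"

definition bounded_lipschitz_domain :: "'a::euclidean_space set \<Rightarrow> bool" where
  "bounded_lipschitz_domain \<Omega> \<longleftrightarrow>
    \<Omega> \<noteq> {} \<and> open \<Omega> \<and> connected \<Omega> \<and> bounded \<Omega> \<and> lipschitz_boundary \<Omega>"

definition exterior :: "'a::euclidean_space set \<Rightarrow> 'a set" where
  "exterior \<Omega> = - closure \<Omega>"

definition frac_const :: "nat \<Rightarrow> real \<Rightarrow> real" where
  "frac_const d s =
    2 powr (2 * s) * s * Gamma (s + real d / 2) / (pi powr (real d / 2) * Gamma (1 - s))"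

(* On the diagonal, a Lebesgue null set, the quotient is 0 / 0 = 0. *)
definition X_inner ::
  "'a::euclidean_space set \<Rightarrow> real \<Rightarrow> ('a \<Rightarrow> real) \<Rightarrow> ('a \<Rightarrow> real) \<Rightarrow> real" where
  "X_inner \<Omega> s u v = frac_const DIM('a) s / 2 *
    (\<integral>(x, y). (u x - u y) * (v x - v y) / norm (x - y) powr (real DIM('a) + 2 * s)
      \<partial>lebesgue_on (- (exterior \<Omega> \<times> exterior \<Omega>)))"

(* The square of the V-norm, as a possibly infinite number. *)
definition V_norm_sq ::
  "'a::euclidean_space set \<Rightarrow> real \<Rightarrow> ('a \<Rightarrow> real) \<Rightarrow> ennreal" where
  "V_norm_sq \<Omega> s v =
    (\<integral>\<^sup>+x. ennreal ((v x)\<^sup>2) \<partial>lebesgue_on \<Omega>) +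
    ennreal (frac_const DIM('a) s / 2) *
      (\<integral>\<^sup>+(x, y). ennreal ((v x - v y)\<^sup>2 / norm (x - y) powr (real DIM('a) + 2 * s))
        \<partial>lebesgue_on (- (exterior \<Omega> \<times> exterior \<Omega>)))"

(* Elements are functions rather than classes; the identification of functions that are
   equal almost everywhere is made explicit where it matters. *)
definition V_space :: "'a::euclidean_space set \<Rightarrow> real \<Rightarrow> ('a \<Rightarrow> real) set" where
  "V_space \<Omega> s = {v \<in> borel_measurable lebesgue. V_norm_sq \<Omega> s v < \<infinity>}"

definition L2_space :: "'a::euclidean_space set \<Rightarrow> ('a \<Rightarrow> real) set" where
  "L2_space A = {f \<in> borel_measurable (lebesgue_on A). integrable (lebesgue_on A) (\<lambda>x. (f x)\<^sup>2)}"

definition L2_inner ::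
  "'a::euclidean_space set \<Rightarrow> ('a \<Rightarrow> real) \<Rightarrow> ('a \<Rightarrow> real) \<Rightarrow> real" where
  "L2_inner A f h = (\<integral>x. f x * h x \<partial>lebesgue_on A)"

(* The space written as the dual of the weighted space L^2_s on A. *)
definition L2s_dual :: "'a::euclidean_space set \<Rightarrow> real \<Rightarrow> ('a \<Rightarrow> real) set" where
  "L2s_dual A s = {g \<in> borel_measurable (lebesgue_on A).
     integrable (lebesgue_on A) (\<lambda>x. (g x)\<^sup>2 * (1 + norm x powr (real DIM('a) + 2 * s)))}"

definition weak_solution ::
  "'a::euclidean_space set \<Rightarrow> real \<Rightarrow> real \<Rightarrow> ('a \<Rightarrow> real) \<Rightarrow> ('a \<Rightarrow> real) \<Rightarrow> ('a \<Rightarrow> real) \<Rightarrow> bool"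
where
  "weak_solution \<Omega> s \<alpha> f g u \<longleftrightarrow> u \<in> V_space \<Omega> s \<and>
    (\<forall>v\<in>V_space \<Omega> s.
       X_inner \<Omega> s u v + \<alpha> * L2_inner \<Omega> u v = L2_inner \<Omega> f v + L2_inner (exterior \<Omega>) g v)"

(* Only the values of w outside large balls matter, so this also applies to a function whose
   values are meaningful only on the exterior of a bounded set. *)
definition ess_lim_at_infinity :: "('a::euclidean_space \<Rightarrow> real) \<Rightarrow> real \<Rightarrow> bool" where
  "ess_lim_at_infinity w l \<longleftrightarrow>
    ((\<lambda>r::real. esssup (lebesgue_on {x. norm x > r}) (\<lambda>x. ereal \<bar>w x - l\<bar>)) \<longlongrightarrow> 0) at_top"

end

theory Submission
  imports Defs
begin

text \<open>
Write \<open>d\<close> for the dimension and \<open>p = d + 2 s\<close>.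

The limit is visible in the Euler equation at exterior points. If a test function is the indicator
of a bounded set far away from \<open>\<Omega>\<close>, the interaction form sees only pairs with one point in that set
and the other in the closure of \<open>\<Omega>\<close>, and \<open>\<Omega>\<close> itself contributes nothing else. Hence, for almost every
\<open>x\<close> with \<open>|x|\<close> large, the integral of \<open>(u(x) - u(y)) / |x - y|^p\<close> over \<open>y\<close> in the closure of \<open>\<Omega>\<close> equals
\<open>g(x)\<close> up to a constant factor (\<open>exterior_equation\<close>). Multiply by \<open>|x|^p\<close>. The kernel ratio
\<open>(|x| / |x - y|)^p\<close> tends to 1 uniformly in \<open>y\<close>, because \<open>\<Omega>\<close> is bounded, and \<open>g(x) |x|^p\<close> tends to 0, so
\<open>u(x)\<close> tends to the mean of \<open>u\<close> over the closure (\<open>deviation_from_mean_le\<close>). The frontier of a Lipschitz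
domain is a null set, as it is locally contained in a Lipschitz graph
(\<open>negligible_frontier_lipschitz_boundary\<close>), so this is the mean over \<open>\<Omega>\<close>. Its value in terms of
\<open>f\<close> and \<open>g\<close> comes from the test function 1.

Existence and uniqueness rest on a single estimate (\<open>weighted_L2_bound\<close>): the integral of
\<open>v\<^sup>2 / (1 + |x|^p)\<close> over the whole space is bounded by the squared norm of \<open>v\<close> in the energy space. It
follows from \<open>v(x)\<^sup>2 \<le> 2 (v(x) - v(y))\<^sup>2 + 2 v(y)\<^sup>2\<close> by averaging over \<open>y \<in> \<Omega>\<close>. The estimate makes the
functional given by \<open>g\<close> bounded, since the weight of \<open>g\<close> is the reciprocal one; it provides an almost
everywhere limit of a rapidly Cauchy sequence, from which completeness follows by Fatou's lemma
(\<open>V_space_complete\<close>); and it shows that a function of energy zero vanishes almost everywhere. The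
solution is then found by minimising the energy (\<open>riesz_representation\<close>).

Elements of the energy space are only Lebesgue measurable, while Fubini's theorem is applied to products
of Borel measures. The passage between the two is by Borel representatives, which change neither the
energy nor the weak formulation.
\<close>

section \<open>Representation of functionals by minimisation\<close>

lemma linear_term_zero:
  fixes b Q :: real
  assumes "\<And>t. 0 \<le> t * b + t\<^sup>2 * Q" and "0 \<le> Q"
  shows "b = 0"
proof -
  define t where "t = - b / (2 * Q + 1)"
  have b: "b = - t * (2 * Q + 1)"
    using assms(2) by (simp add: t_def)
  have "0 \<le> t * b + t\<^sup>2 * Q" by (rule assms)
  also have "\<dots> = - (t\<^sup>2 * (Q + 1))"
    unfolding b by (simp add: algebra_simps power2_eq_square)
  finally have "t\<^sup>2 * (Q + 1) \<le> 0" by simp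
  then have "t = 0"
    using assms(2) by (auto simp: mult_le_0_iff)
  then show ?thesis using b by simp
qed

text \<open>The direct method: a minimising sequence of \<open>J v = a v v - 2 l v\<close> is Cauchy by the
parallelogram law, and its limit is a critical point of \<open>J\<close>. The space is a set of functions
closed under pointwise linear combinations, and \<open>a\<close> is semidefinite rather than definite,
because elements of the energy space are functions and not classes. The bound on \<open>l\<close> is affine in \<open>a v v\<close> so that
it can be checked with pointwise inequalities of the form \<open>|x y| \<le> x\<^sup>2 + y\<^sup>2\<close>; linearity of \<open>l\<close>
upgrades it by scaling to the usual bound.\<close>
lemma riesz_representation:
  fixes V :: "('a \<Rightarrow> real) set" and a :: "('a \<Rightarrow> real) \<Rightarrow> ('a \<Rightarrow> real) \<Rightarrow> real"
    and l :: "('a \<Rightarrow> real) \<Rightarrow> real"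
  assumes ne: "V \<noteq> {}"
    and lin: "\<And>u v c. u \<in> V \<Longrightarrow> v \<in> V \<Longrightarrow> (\<lambda>x. u x + c * v x) \<in> V"
    and a_sym: "\<And>u v. u \<in> V \<Longrightarrow> v \<in> V \<Longrightarrow> a u v = a v u"
    and a_lin: "\<And>u v w c. u \<in> V \<Longrightarrow> v \<in> V \<Longrightarrow> w \<in> V \<Longrightarrow>
                  a (\<lambda>x. u x + c * v x) w = a u w + c * a v w"
    and a_nonneg: "\<And>v. v \<in> V \<Longrightarrow> 0 \<le> a v v"
    and l_lin: "\<And>u v c. u \<in> V \<Longrightarrow> v \<in> V \<Longrightarrow> l (\<lambda>x. u x + c * v x) = l u + c * l v"
    and l_bound: "\<And>v. v \<in> V \<Longrightarrow> \<bar>l v\<bar> \<le> C * (1 + a v v)"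
    and complete: "\<And>X. (\<And>n. X n \<in> V) \<Longrightarrow>
          (\<And>e. 0 < e \<Longrightarrow> \<exists>N. \<forall>m\<ge>N. \<forall>n\<ge>N.
              a (\<lambda>x. X m x - X n x) (\<lambda>x. X m x - X n x) < e) \<Longrightarrow>
          \<exists>u\<in>V. (\<lambda>n. a (\<lambda>x. X n x - u x) (\<lambda>x. X n x - u x)) \<longlonglongrightarrow> 0"
  shows "\<exists>u\<in>V. \<forall>v\<in>V. a u v = l v"
proof -
  define J where "J v = a v v - 2 * l v" for v
  have quad: "a (\<lambda>x. u x + c * v x) (\<lambda>x. u x + c * v x) = a u u + 2 * c * a u v + c\<^sup>2 * a v v"
    if "u \<in> V" "v \<in> V" for u v c
  proof -
    have "a u (\<lambda>x. u x + c * v x) = a u u + c * a v u" "a v (\<lambda>x. u x + c * v x) = a u v + c * a v v"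
      using that a_sym[OF _ lin[OF that]] a_lin[OF that] a_sym by auto
    then show ?thesis
      using a_lin[OF that lin[OF that]] a_sym[OF that] by (simp add: algebra_simps power2_eq_square)
  qed
  have J_quad: "J (\<lambda>x. u x + c * v x) = J u + 2 * c * (a u v - l v) + c\<^sup>2 * a v v"
    if "u \<in> V" "v \<in> V" for u v c
    using quad[OF that, of c] l_lin[OF that, of c] by (simp add: J_def algebra_simps)
  have diff: "(\<lambda>x. u x - v x) \<in> V" if "u \<in> V" "v \<in> V" for u v
    using lin[OF that, of "-1"] by simp
  define B where "B = \<bar>C\<bar> + 1"
  have B: "0 < B" "C \<le> B" by (auto simp: B_def)
  have J_lower: "- (4 * B\<^sup>2) \<le> J v" if "v \<in> V" for v
  proof -
    \<comment> \<open>Scaling turns the bound on \<open>l\<close> into one whose quadratic part has a small coefficient.\<close>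
    define t where "t = 1 / (2 * B)"
    have t: "0 < t" using B by (simp add: t_def)
    have z: "(\<lambda>x. v x + (t - 1) * v x) \<in> V" using lin[OF that that] .
    have "\<bar>l v + (t - 1) * l v\<bar> \<le> C * (1 + (a v v + 2 * (t - 1) * a v v + (t - 1)\<^sup>2 * a v v))"
      using l_bound[OF z] l_lin[OF that that, of "t - 1"] quad[OF that that, of "t - 1"] by simp
    also have "\<dots> = C * (1 + t\<^sup>2 * a v v)"
      by (simp add: algebra_simps power2_eq_square)
    also have "\<dots> \<le> B * (1 + t\<^sup>2 * a v v)"
      using B a_nonneg[OF that] by (intro mult_right_mono) auto
    finally have "t * \<bar>l v\<bar> \<le> B * (1 + t\<^sup>2 * a v v)"
      using t by (simp add: algebra_simps abs_mult)
    then have "2 * B * (t * \<bar>l v\<bar>) \<le> 2 * B * (B * (1 + t\<^sup>2 * a v v))"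
      using B by (intro mult_left_mono) auto
    also have "2 * B * (t * \<bar>l v\<bar>) = (2 * B * t) * \<bar>l v\<bar>" by simp
    also have "2 * B * (B * (1 + t\<^sup>2 * a v v)) = 2 * B\<^sup>2 + (2 * B * t)\<^sup>2 * a v v / 2"
      by (simp add: algebra_simps power2_eq_square)
    also have "2 * B * t = 1" using B by (simp add: t_def)
    finally have "\<bar>l v\<bar> \<le> 2 * B\<^sup>2 + a v v / 2" by simp
    then show ?thesis unfolding J_def by linarith
  qed
  then have bdd: "bdd_below (J ` V)" by (auto intro!: bdd_belowI2)
  define j where "j = Inf (J ` V)"
  have j_le: "j \<le> J v" if "v \<in> V" for v
    unfolding j_def using that bdd by (intro cInf_lower) auto
  have "\<exists>v\<in>V. J v < j + 1 / real (Suc n)" for n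
  proof -
    have "\<exists>y\<in>J ` V. y < j + 1 / real (Suc n)"
      unfolding j_def by (rule cInf_lessD) (use ne in auto)
    then show ?thesis by auto
  qed
  then obtain X where X: "\<And>n. X n \<in> V" "\<And>n. J (X n) < j + 1 / real (Suc n)"
    by metis
  have parallelogram: "a (\<lambda>x. u x - v x) (\<lambda>x. u x - v x) \<le> 2 * (J u - j) + 2 * (J v - j)"
    if "u \<in> V" "v \<in> V" for u v
  proof -
    \<comment> \<open>The infimum \<open>j\<close> is compared with the value at the midpoint of \<open>u\<close> and \<open>v\<close>.\<close>
    have "j \<le> J (\<lambda>x. u x + (1/2) * (v x - u x))"
      using j_le lin[OF that(1) diff[OF that(2,1)], of "1/2"] by simp
    also have "\<dots> = J u + (a u (\<lambda>x. v x - u x) - l (\<lambda>x. v x - u x))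
        + (1/4) * a (\<lambda>x. v x - u x) (\<lambda>x. v x - u x)"
      using J_quad[OF that(1) diff[OF that(2,1)], of "1/2"] by (simp add: power2_eq_square)
    also have "a u (\<lambda>x. v x - u x) = a u v - a u u"
      using a_lin[OF that(2,1,1), of "-1"] a_sym[OF that(1) diff[OF that(2,1)]] a_sym[OF that]
      by simp
    also have "l (\<lambda>x. v x - u x) = l v - l u"
      using l_lin[OF that(2,1), of "-1"] by simp
    finally have 1: "j \<le> J u + (a u v - a u u - (l v - l u))
        + (1/4) * a (\<lambda>x. v x - u x) (\<lambda>x. v x - u x)" .
    have 2: "a (\<lambda>x. v x - u x) (\<lambda>x. v x - u x) = a v v - 2 * a u v + a u u"
      using quad[OF that(2,1), of "-1"] a_sym[OF that] by simp
    have 3: "a (\<lambda>x. u x - v x) (\<lambda>x. u x - v x) = a v v - 2 * a u v + a u u"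
      using quad[OF that, of "-1"] by simp
    show ?thesis using 1 unfolding 2 3 J_def by (simp add: field_simps)
  qed
  have "\<exists>u\<in>V. (\<lambda>n. a (\<lambda>x. X n x - u x) (\<lambda>x. X n x - u x)) \<longlonglongrightarrow> 0"
  proof (rule complete)
    fix e :: real assume "0 < e"
    then obtain N where N: "1 / real (Suc N) < e / 4"
      using nat_approx_posE[of "e / 4"] by auto
    have small: "J (X m) - j < e / 4" if "m \<ge> N" for m
    proof -
      have "1 / real (Suc m) \<le> 1 / real (Suc N)" using that by (simp add: frac_le)
      then show ?thesis using X(2)[of m] N by linarith
    qed
    have "a (\<lambda>x. X m x - X n x) (\<lambda>x. X m x - X n x) < e" if "m \<ge> N" "n \<ge> N" for m n
      by (rule le_less_trans[OF parallelogram[OF X(1) X(1), of m n]])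
         (use small[OF that(1)] small[OF that(2)] in simp)
    then show "\<exists>N. \<forall>m\<ge>N. \<forall>n\<ge>N. a (\<lambda>x. X m x - X n x) (\<lambda>x. X m x - X n x) < e"
      by blast
  qed (rule X)
  then obtain u where u: "u \<in> V" "(\<lambda>n. a (\<lambda>x. X n x - u x) (\<lambda>x. X n x - u x)) \<longlonglongrightarrow> 0"
    by blast
  have "a u v = l v" if v: "v \<in> V" for v
  proof -
    \<comment> \<open>The first variation at the limit. It is obtained from \<open>j \<le> J (X n + t v)\<close> as \<open>n\<close> grows; the
      mixed term \<open>a (X n - u) v\<close> is absorbed by \<open>0 \<le> a (w - t v) (w - t v)\<close> with \<open>w = X n - u\<close>, so the
      quadratic coefficient doubles.\<close>
    have "0 \<le> t * (2 * (a u v - l v)) + t\<^sup>2 * (2 * a v v)" for t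
    proof (rule LIMSEQ_le_const)
      have "(\<lambda>n. 2 * t * (a u v - l v) + 2 * t\<^sup>2 * a v v
          + (a (\<lambda>x. X n x - u x) (\<lambda>x. X n x - u x) + 1 / real (Suc n)))
          \<longlonglongrightarrow> 2 * t * (a u v - l v) + 2 * t\<^sup>2 * a v v + (0 + 0)"
        using LIMSEQ_inverse_real_of_nat
        by (intro tendsto_add tendsto_const u(2)) (simp add: field_simps)
      then show "(\<lambda>n. 2 * t * (a u v - l v) + 2 * t\<^sup>2 * a v v
          + (a (\<lambda>x. X n x - u x) (\<lambda>x. X n x - u x) + 1 / real (Suc n)))
          \<longlonglongrightarrow> t * (2 * (a u v - l v)) + t\<^sup>2 * (2 * a v v)"
        by (simp add: algebra_simps)
      have "0 \<le> 2 * t * (a u v - l v) + 2 * t\<^sup>2 * a v v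
          + (a (\<lambda>x. X n x - u x) (\<lambda>x. X n x - u x) + 1 / real (Suc n))" for n
      proof -
        define w where "w = (\<lambda>x. X n x - u x)"
        have w: "w \<in> V" unfolding w_def using X(1) u(1) by (rule diff)
        have "j \<le> J (X n) + 2 * t * (a (X n) v - l v) + t\<^sup>2 * a v v"
          using j_le[OF lin[OF X(1) v, of n t]] J_quad[OF X(1) v, of n t] by simp
        moreover have "a (X n) v = a u v + a w v"
          using a_lin[OF X(1)[of n] u(1) v, of "-1"] by (simp add: w_def)
        moreover have "0 \<le> a w w - 2 * t * a w v + t\<^sup>2 * a v v"
          using a_nonneg[OF lin[OF w v, of "-t"]] quad[OF w v, of "-t"] by simp
        ultimately have "0 \<le> 2 * t * (a u v - l v) + 2 * t\<^sup>2 * a v v + (a w w + 1 / real (Suc n))"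
          using X(2)[of n] by (simp add: algebra_simps)
        then show ?thesis unfolding w_def .
      qed
      then show "\<exists>N. \<forall>n\<ge>N. 0 \<le> 2 * t * (a u v - l v) + 2 * t\<^sup>2 * a v v
          + (a (\<lambda>x. X n x - u x) (\<lambda>x. X n x - u x) + 1 / real (Suc n))" by blast
    qed
    then have "2 * (a u v - l v) = 0"
      by (rule linear_term_zero) (use a_nonneg[OF v] in simp)
    then show ?thesis by simp
  qed
  then show ?thesis using u(1) by blast
qed

section \<open>Square-integrable functions\<close>

lemma L2_space_iff:
  "f \<in> L2_space A \<longleftrightarrow> f \<in> borel_measurable (lebesgue_on A) \<and>
     (\<integral>\<^sup>+x. ennreal ((f x)\<^sup>2) \<partial>lebesgue_on A) < \<infinity>"
  unfolding L2_space_def integrable_iff_bounded by auto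

lemma L2_space_measurable: "f \<in> L2_space A \<Longrightarrow> f \<in> borel_measurable (lebesgue_on A)"
  by (simp add: L2_space_def)

lemma L2_inner_commute: "L2_inner A f h = L2_inner A h f"
  unfolding L2_inner_def by (simp add: mult.commute)

lemma L2_inner_self_nonneg: "0 \<le> L2_inner A f f"
  unfolding L2_inner_def by (rule integral_nonneg_AE) auto

lemma nn_integral_square_L2:
  assumes "f \<in> L2_space A"
  shows "(\<integral>\<^sup>+x. ennreal ((f x)\<^sup>2) \<partial>lebesgue_on A) = ennreal (L2_inner A f f)"
proof -
  have "integrable (lebesgue_on A) (\<lambda>x. (f x)\<^sup>2)"
    using assms by (simp add: L2_space_def)
  then have "(\<integral>\<^sup>+x. ennreal ((f x)\<^sup>2) \<partial>lebesgue_on A) = ennreal (\<integral>x. (f x)\<^sup>2 \<partial>lebesgue_on A)"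
    by (intro nn_integral_eq_integral) auto
  then show ?thesis by (simp add: L2_inner_def power2_eq_square)
qed

lemma abs_mult_le_sum_squares: "\<bar>a * b\<bar> \<le> a\<^sup>2 + b\<^sup>2" for a b :: real
proof -
  have "0 \<le> (a + b)\<^sup>2" "0 \<le> (a - b)\<^sup>2" "0 \<le> a\<^sup>2" "0 \<le> b\<^sup>2" by simp_all
  then show ?thesis unfolding power2_sum power2_diff by linarith
qed

lemma integrable_mult_L2:
  assumes "f \<in> L2_space A" "h \<in> L2_space A"
  shows "integrable (lebesgue_on A) (\<lambda>x. f x * h x)"
proof (rule Bochner_Integration.integrable_bound)
  show "integrable (lebesgue_on A) (\<lambda>x. (f x)\<^sup>2 + (h x)\<^sup>2)"
    using assms by (simp add: L2_space_def)
  show "(\<lambda>x. f x * h x) \<in> borel_measurable (lebesgue_on A)"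
    using assms by (intro borel_measurable_times) (auto simp: L2_space_def)
  have "\<bar>f x * h x\<bar> \<le> (f x)\<^sup>2 + (h x)\<^sup>2" for x
    by (rule abs_mult_le_sum_squares)
  then show "AE x in lebesgue_on A. norm (f x * h x) \<le> norm ((f x)\<^sup>2 + (h x)\<^sup>2)"
    by auto
qed

lemma L2_inner_linear:
  assumes "f \<in> L2_space A" "h \<in> L2_space A" "w \<in> L2_space A"
  shows "L2_inner A (\<lambda>x. f x + c * h x) w = L2_inner A f w + c * L2_inner A h w"
  using integrable_mult_L2[OF assms(1,3)] integrable_mult_L2[OF assms(2,3)]
  unfolding L2_inner_def by (simp add: algebra_simps)

lemma L2_space_lincomb:
  assumes "f \<in> L2_space A" "h \<in> L2_space A"
  shows "(\<lambda>x. f x + c * h x) \<in> L2_space A"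
proof -
  have "integrable (lebesgue_on A) (\<lambda>x. (f x)\<^sup>2 + c\<^sup>2 * (h x)\<^sup>2 + 2 * c * (f x * h x))"
    using assms integrable_mult_L2[OF assms] by (simp add: L2_space_def)
  moreover have "(\<lambda>x. (f x)\<^sup>2 + c\<^sup>2 * (h x)\<^sup>2 + 2 * c * (f x * h x)) = (\<lambda>x. (f x + c * h x)\<^sup>2)"
    by (simp add: fun_eq_iff algebra_simps power2_eq_square)
  ultimately show ?thesis
    using assms by (auto simp: L2_space_def)
qed

lemma L2_inner_abs_le:
  assumes "f \<in> L2_space A" "h \<in> L2_space A"
  shows "\<bar>L2_inner A f h\<bar> \<le> L2_inner A f f + L2_inner A h h"
proof -
  have q: "L2_inner A (\<lambda>x. f x + c * h x) (\<lambda>x. f x + c * h x) =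
      L2_inner A f f + 2 * c * L2_inner A f h + c\<^sup>2 * L2_inner A h h" for c
    using L2_inner_linear[OF assms L2_space_lincomb[OF assms], of c c]
      L2_inner_linear[OF assms assms(1), of c] L2_inner_linear[OF assms assms(2), of c]
    by (simp add: L2_inner_commute[of A f "\<lambda>x. f x + c * h x"]
        L2_inner_commute[of A h "\<lambda>x. f x + c * h x"] L2_inner_commute[of A h f]
        algebra_simps power2_eq_square)
  have "0 \<le> L2_inner A f f + 2 * L2_inner A f h + L2_inner A h h"
    "0 \<le> L2_inner A f f - 2 * L2_inner A f h + L2_inner A h h"
    using q[of 1] q[of "-1"] L2_inner_self_nonneg[of A "\<lambda>x. f x + 1 * h x"]
      L2_inner_self_nonneg[of A "\<lambda>x. f x + (-1) * h x"] by simp_all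
  then show ?thesis
    using L2_inner_self_nonneg[of A f] L2_inner_self_nonneg[of A h] by linarith
qed

text \<open>Closed balls of \<open>L\<^sup>2\<close> are closed under almost everywhere convergence. This is what makes the energy
space complete once an almost everywhere limit has been found.\<close>
lemma L2_fatou:
  assumes f: "\<And>n. f n \<in> L2_space A" and h: "h \<in> borel_measurable (lebesgue_on A)"
    and lim: "AE x in lebesgue_on A. (\<lambda>n. f n x) \<longlonglongrightarrow> h x"
    and bound: "\<And>n. N \<le> n \<Longrightarrow> L2_inner A (f n) (f n) \<le> c"
  shows "h \<in> L2_space A" "L2_inner A h h \<le> c"
proof -
  have "(\<integral>\<^sup>+x. ennreal ((h x)\<^sup>2) \<partial>lebesgue_on A)
      \<le> (\<integral>\<^sup>+x. liminf (\<lambda>n. ennreal ((f n x)\<^sup>2)) \<partial>lebesgue_on A)"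
  proof (rule nn_integral_mono_AE, use lim in eventually_elim)
    case (elim x)
    then have "(\<lambda>n. ennreal ((f n x)\<^sup>2)) \<longlonglongrightarrow> ennreal ((h x)\<^sup>2)"
      by (intro tendsto_ennrealI tendsto_power)
    from lim_imp_Liminf[OF sequentially_bot this] show ?case by simp
  qed
  also have "\<dots> \<le> liminf (\<lambda>n. \<integral>\<^sup>+x. ennreal ((f n x)\<^sup>2) \<partial>lebesgue_on A)"
    using L2_space_measurable[OF f] by (intro nn_integral_liminf) measurable
  also have "\<dots> \<le> liminf (\<lambda>n. ennreal c)"
  proof (rule Liminf_mono)
    show "\<forall>\<^sub>F n in sequentially. (\<integral>\<^sup>+x. ennreal ((f n x)\<^sup>2) \<partial>lebesgue_on A) \<le> ennreal c"
      using eventually_ge_at_top[of N]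
      by eventually_elim (simp add: nn_integral_square_L2[OF f] bound ennreal_leI)
  qed
  also have "\<dots> = ennreal c" by (simp add: Liminf_const)
  finally have le: "(\<integral>\<^sup>+x. ennreal ((h x)\<^sup>2) \<partial>lebesgue_on A) \<le> ennreal c" .
  show L2: "h \<in> L2_space A"
    using h le_less_trans[OF le] by (simp add: L2_space_iff)
  have "0 \<le> c"
    using bound[of N] L2_inner_self_nonneg[of A "f N"] by simp
  then show "L2_inner A h h \<le> c"
    using le nn_integral_square_L2[OF L2] by simp
qed

section \<open>The energy space in terms of difference quotients\<close>

definition interaction_region :: "'a::euclidean_space set \<Rightarrow> ('a \<times> 'a) set" where
  "interaction_region \<Omega> = - (exterior \<Omega> \<times> exterior \<Omega>)"

text \<open>The kernel is split symmetrically between the two factors of the interaction form. The form then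
becomes an \<open>L\<^sup>2\<close> inner product of difference quotients over the interaction region, and
membership in the energy space becomes square-integrability of \<open>v\<close> and of \<open>diff_quot s v\<close>, which is
linear in \<open>v\<close>. Quotients on the diagonal are \<open>0 / 0 = 0\<close>.\<close>
definition diff_quot :: "real \<Rightarrow> ('a::euclidean_space \<Rightarrow> real) \<Rightarrow> 'a \<times> 'a \<Rightarrow> real" where
  "diff_quot s v = (\<lambda>(x, y). (v x - v y) / norm (x - y) powr ((real DIM('a) + 2 * s) / 2))"

lemma diff_quot_mult:
  fixes u v :: "'a::euclidean_space \<Rightarrow> real"
  shows "diff_quot s u (x, y) * diff_quot s v (x, y) =
    (u x - u y) * (v x - v y) / norm (x - y) powr (real DIM('a) + 2 * s)"
proof -
  have "norm (x - y) powr ((real DIM('a) + 2 * s) / 2) * norm (x - y) powr ((real DIM('a) + 2 * s) / 2)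
      = norm (x - y) powr (real DIM('a) + 2 * s)"
    unfolding powr_add[symmetric] by simp
  then show ?thesis by (simp add: diff_quot_def)
qed

lemma diff_quot_lincomb:
  "diff_quot s (\<lambda>x. u x + c * v x) = (\<lambda>z. diff_quot s u z + c * diff_quot s v z)"
  unfolding diff_quot_def by (auto simp: fun_eq_iff diff_divide_distrib add_divide_distrib algebra_simps)

lemma frac_const_pos:
  assumes "0 < s" "s < 1"
  shows "0 < frac_const d s"
  unfolding frac_const_def using assms
  by (intro divide_pos_pos mult_pos_pos Gamma_real_pos) auto

lemma X_inner_eq: "X_inner \<Omega> s u v =
    frac_const DIM('a) s / 2 * L2_inner (interaction_region \<Omega>) (diff_quot s u) (diff_quot s v)"
  for u v :: "'a::euclidean_space \<Rightarrow> real"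
  unfolding X_inner_def L2_inner_def interaction_region_def[symmetric]
  by (simp add: case_prod_beta' diff_quot_mult[symmetric])

text \<open>If \<open>N\<close> is a null set, so are \<open>N \<times> UNIV\<close> and \<open>UNIV \<times> N\<close>. Hence functions on the space may be
replaced by Borel representatives inside double integrals, where Tonelli and Fubini apply to the
product of the Borel measures.\<close>
lemma AE_lebesgue_fst_snd:
  fixes P :: "'a::euclidean_space \<Rightarrow> bool"
  assumes "AE x in lebesgue. P x"
  shows "AE z in (lebesgue :: ('a \<times> 'a) measure). P (fst z) \<and> P (snd z)"
proof -
  have "AE x in lborel. P x"
    using assms by (simp add: AE_completion_iff)
  then obtain N where N: "{x. \<not> P x} \<subseteq> N" "N \<in> null_sets lborel"
    by (auto elim!: AE_E simp: null_sets_def)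
  have "N \<times> UNIV \<in> null_sets (lborel \<Otimes>\<^sub>M lborel)" "UNIV \<times> N \<in> null_sets (lborel \<Otimes>\<^sub>M lborel)"
    using N by auto
  then have "N \<times> UNIV \<union> UNIV \<times> N \<in> null_sets (lborel :: ('a \<times> 'a) measure)"
    unfolding lborel_prod by auto
  then have "AE z in (lborel :: ('a \<times> 'a) measure). z \<notin> N \<times> UNIV \<union> UNIV \<times> N"
    by (rule AE_not_in)
  then have "AE z in (lborel :: ('a \<times> 'a) measure). P (fst z) \<and> P (snd z)"
    by eventually_elim (use N in auto)
  then show ?thesis by (rule AE_completion)
qed

lemma borel_representative:
  fixes v :: "'a::euclidean_space \<Rightarrow> real"
  assumes "v \<in> borel_measurable lebesgue"
  obtains w where "w \<in> borel_measurable borel" "AE x in lebesgue. v x = w x"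
  using completion_ex_borel_measurable_real[OF assms] by (auto intro: AE_completion)

lemma diff_quot_measurable_borel:
  fixes v :: "'a::euclidean_space \<Rightarrow> real"
  assumes "v \<in> borel_measurable borel"
  shows "diff_quot s v \<in> borel_measurable borel"
proof -
  note [measurable] = assms
  show ?thesis unfolding diff_quot_def borel_prod[symmetric] by measurable
qed

lemma diff_quot_cong_AE:
  fixes v w :: "'a::euclidean_space \<Rightarrow> real"
  assumes "AE x in lebesgue. v x = w x"
  shows "AE z in lebesgue. diff_quot s v z = diff_quot s w z"
  using AE_lebesgue_fst_snd[OF assms] by eventually_elim (auto simp: diff_quot_def split: prod.split)

lemma diff_quot_measurable:
  fixes v :: "'a::euclidean_space \<Rightarrow> real"
  assumes "v \<in> borel_measurable lebesgue"
  shows "diff_quot s v \<in> borel_measurable lebesgue"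
proof -
  obtain w where w: "w \<in> borel_measurable borel" "AE x in lebesgue. v x = w x"
    using borel_representative[OF assms] .
  have "diff_quot s w \<in> borel_measurable lebesgue"
    using diff_quot_measurable_borel[OF w(1)] by (intro measurable_completion) simp
  then show ?thesis
    using diff_quot_cong_AE[OF w(2), of s] by (rule borel_measurable_AE[OF _ AE_mp]) (simp add: eq_commute)
qed

lemma sets_interaction_region: "interaction_region \<Omega> \<in> sets borel"
  unfolding interaction_region_def exterior_def
  by (intro borel_comp borel_open open_Times open_Compl) auto

lemma V_space_iff:
  fixes v :: "'a::euclidean_space \<Rightarrow> real"
  assumes "0 < s" "s < 1"
  shows "v \<in> V_space \<Omega> s \<longleftrightarrow> v \<in> borel_measurable lebesgue \<and> v \<in> L2_space \<Omega> \<and>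
           diff_quot s v \<in> L2_space (interaction_region \<Omega>)"
proof -
  have "0 < frac_const DIM('a) s" by (rule frac_const_pos[OF assms])
  then have "V_norm_sq \<Omega> s v < \<infinity> \<longleftrightarrow> (\<integral>\<^sup>+x. ennreal ((v x)\<^sup>2) \<partial>lebesgue_on \<Omega>) < \<infinity> \<and>
     (\<integral>\<^sup>+z. ennreal ((diff_quot s v z)\<^sup>2) \<partial>lebesgue_on (interaction_region \<Omega>)) < \<infinity>"
    unfolding V_norm_sq_def interaction_region_def[symmetric]
    by (simp add: case_prod_beta' diff_quot_mult[symmetric] power2_eq_square ennreal_mult_less_top ennreal_add_eq_top ennreal_mult_eq_top_iff less_top[symmetric])
  then show ?thesis
    using diff_quot_measurable[of v s]
    by (auto simp: V_space_def L2_space_iff intro: measurable_restrict_space1)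
qed

lemma AE_lebesgue_onI:
  assumes "AE x in lebesgue. P x" "A \<in> sets lebesgue"
  shows "AE x in lebesgue_on A. P x"
  using assms by (subst AE_restrict_space_iff) auto

lemma L2_cong_AE:
  fixes v w h :: "'a::euclidean_space \<Rightarrow> real"
  assumes A: "A \<in> sets lebesgue" and ae: "AE x in lebesgue. w x = v x"
    and meas: "w \<in> borel_measurable lebesgue" and v: "v \<in> L2_space A"
  shows L2_space_cong_AE: "w \<in> L2_space A"
    and L2_inner_cong_AE: "h \<in> borel_measurable (lebesgue_on A) \<Longrightarrow> L2_inner A w h = L2_inner A v h"
proof -
  note ae' = AE_lebesgue_onI[OF ae A]
  have w: "w \<in> borel_measurable (lebesgue_on A)"
    using meas by (rule measurable_restrict_space1)
  have "(\<integral>\<^sup>+x. ennreal ((w x)\<^sup>2) \<partial>lebesgue_on A) = (\<integral>\<^sup>+x. ennreal ((v x)\<^sup>2) \<partial>lebesgue_on A)"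
    using ae' by (intro nn_integral_cong_AE) auto
  then show "w \<in> L2_space A"
    using v w by (simp add: L2_space_iff)
  show "L2_inner A w h = L2_inner A v h" if "h \<in> borel_measurable (lebesgue_on A)"
    unfolding L2_inner_def using that w v ae'
    by (intro integral_cong_AE borel_measurable_times) (auto simp: L2_space_def)
qed

lemma weak_solution_cong_AE:
  fixes u w :: "'a::euclidean_space \<Rightarrow> real"
  assumes s: "0 < s" "s < 1" and \<Omega>: "\<Omega> \<in> sets lebesgue"
    and u: "weak_solution \<Omega> s \<alpha> f g u"
    and w: "w \<in> borel_measurable lebesgue" "AE x in lebesgue. w x = u x"
  shows "weak_solution \<Omega> s \<alpha> f g w"
proof -
  let ?D = "interaction_region \<Omega>"
  have D: "?D \<in> sets lebesgue"
    using sets_interaction_region by (intro sets_completionI_sets) simp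
  have uV: "u \<in> V_space \<Omega> s" using u by (simp add: weak_solution_def)
  note u2 = uV[unfolded V_space_iff[OF s]]
  have \<Omega>_cong: "w \<in> L2_space \<Omega>"
    "\<And>h. h \<in> borel_measurable (lebesgue_on \<Omega>) \<Longrightarrow> L2_inner \<Omega> w h = L2_inner \<Omega> u h"
    using L2_cong_AE[OF \<Omega> w(2,1)] u2 by auto
  have D_cong: "diff_quot s w \<in> L2_space ?D"
    "\<And>h. h \<in> borel_measurable (lebesgue_on ?D) \<Longrightarrow>
       L2_inner ?D (diff_quot s w) h = L2_inner ?D (diff_quot s u) h"
    using L2_cong_AE[OF D diff_quot_cong_AE[OF w(2)] diff_quot_measurable[OF w(1)]] u2 by auto
  have "X_inner \<Omega> s w v + \<alpha> * L2_inner \<Omega> w v = X_inner \<Omega> s u v + \<alpha> * L2_inner \<Omega> u v"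
    if "v \<in> V_space \<Omega> s" for v
  proof -
    have "v \<in> L2_space \<Omega>" "diff_quot s v \<in> L2_space ?D"
      using that by (simp_all add: V_space_iff[OF s])
    then show ?thesis
      by (simp add: X_inner_eq \<Omega>_cong(2) D_cong(2) L2_space_measurable)
  qed
  then show ?thesis
    using u w(1) \<Omega>_cong(1) D_cong(1)
    unfolding weak_solution_def by (auto simp: V_space_iff[OF s])
qed

section \<open>The weighted estimate\<close>

definition weight :: "real \<Rightarrow> 'a::euclidean_space \<Rightarrow> real" where
  "weight s x = 1 / (1 + norm x powr (real DIM('a) + 2 * s))"

lemma weight_pos: "0 < weight s x" and weight_le_1: "weight s x \<le> 1"
  unfolding weight_def by (auto simp: add_pos_nonneg divide_le_eq)

lemma weight_measurable [measurable]: "weight s \<in> borel_measurable borel"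
  unfolding weight_def by measurable

text \<open>On the ball of radius \<open>2 ^ k\<close>, off the ball of half that radius, the weight is at most a constant
times \<open>2 powr (- k * (d + 2 * s))\<close>, while the volume of the ball grows like \<open>2 powr (k * d)\<close>. The
remaining factors \<open>2 powr (- 2 * s * k)\<close> form a convergent geometric series.\<close>
lemma nn_integral_weight_finite:
  assumes "0 < s"
  shows "(\<integral>\<^sup>+x. ennreal (weight s (x::'a::euclidean_space)) \<partial>lborel) < \<infinity>"
proof -
  define p where "p = real DIM('a) + 2 * s"
  have p: "0 < p" using assms by (simp add: p_def add_nonneg_pos)
  define c where "c k = 2 powr p * 2 powr (- real k * p)" for k
  have c: "0 \<le> c k" for k by (simp add: c_def)
  have term_le: "F k \<le> suminf F" for F :: "nat \<Rightarrow> ennreal" and k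
    using sum_le_suminf[of F "{k}"] by simp
  have bound: "ennreal (weight s x) \<le> (\<Sum>k. ennreal (c k) * indicator (ball 0 (2 ^ k)) x)" for x :: 'a
  proof -
    define k where "k = (LEAST k. norm x < 2 ^ k)"
    have "\<exists>k. norm x < 2 ^ k" using real_arch_pow[of 2 "norm x"] by simp
    then have k: "norm x < 2 ^ k" unfolding k_def by (rule LeastI_ex)
    have "weight s x \<le> c k"
    proof (cases k)
      case 0
      have "weight s x \<le> 1" by (rule weight_le_1)
      also have "1 \<le> c k" using p by (simp add: c_def 0 ge_one_powr_ge_zero)
      finally show ?thesis .
    next
      case (Suc n)
      have "\<not> norm x < 2 ^ n" using not_less_Least[of n "\<lambda>k. norm x < 2 ^ k"] Suc by (simp add: k_def)
      then have "(2 powr real n) powr p \<le> norm x powr p"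
        using p by (intro powr_mono2) (auto simp: powr_realpow)
      also have "\<dots> \<le> 1 + norm x powr p" by simp
      finally have "weight s x \<le> 1 / (2 powr real n) powr p"
        unfolding weight_def p_def[symmetric] by (intro divide_left_mono) (auto simp: add_pos_nonneg)
      also have "\<dots> = c k"
        unfolding c_def Suc by (simp add: powr_powr powr_minus_divide powr_add[symmetric] powr_diff[symmetric] powr_minus[symmetric] field_simps)
      finally show ?thesis .
    qed
    then have "ennreal (weight s x) \<le> ennreal (c k) * indicator (ball 0 (2 ^ k)) x"
      using k by (simp add: ennreal_leI)
    also have "\<dots> \<le> (\<Sum>k. ennreal (c k) * indicator (ball 0 (2 ^ k)) x)"
      by (rule term_le)
    finally show ?thesis .
  qed
  have "(\<integral>\<^sup>+x. ennreal (weight s (x::'a)) \<partial>lborel)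
      \<le> (\<integral>\<^sup>+x. (\<Sum>k. ennreal (c k) * indicator (ball 0 (2 ^ k)) x) \<partial>(lborel :: 'a measure))"
    by (intro nn_integral_mono bound)
  also have "\<dots> = (\<Sum>k. ennreal (c k) * emeasure lborel (ball (0::'a) (2 ^ k)))"
  proof -
    have ball: "ball (0::'a) r \<in> sets lborel" for r by simp
    show ?thesis
      using ball by (subst nn_integral_suminf)
        (auto intro!: borel_measurable_times_ennreal borel_measurable_indicator suminf_cong nn_integral_cmult_indicator)
  qed
  also have "\<dots> = (\<Sum>k. ennreal (2 powr p * unit_ball_vol (real DIM('a)) * (2 powr (- 2 * s)) ^ k))"
  proof (intro suminf_cong)
    fix k
    have "c k * (unit_ball_vol (real DIM('a)) * (2 ^ k) ^ DIM('a)) =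
        2 powr p * unit_ball_vol (real DIM('a)) * (2 powr (- real k * p) * 2 powr (real k * real DIM('a)))"
      by (simp add: c_def powr_realpow[symmetric] powr_powr)
    also have "2 powr (- real k * p) * 2 powr (real k * real DIM('a)) = (2 powr (- 2 * s)) powr real k"
      unfolding powr_add[symmetric] powr_powr by (simp add: p_def algebra_simps)
    finally show "ennreal (c k) * emeasure lborel (ball (0::'a) (2 ^ k)) =
        ennreal (2 powr p * unit_ball_vol (real DIM('a)) * (2 powr (- 2 * s)) ^ k)"
      using c[of k] by (simp add: emeasure_ball ennreal_mult''[symmetric] powr_realpow)
  qed
  also have "\<dots> < \<infinity>"
  proof -
    have "summable (\<lambda>k. (2 powr (- 2 * s)) ^ k)"
      using assms by (intro summable_geometric) (simp add: powr_less_one)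
    then have "(\<Sum>k. ennreal (2 powr p * unit_ball_vol (real DIM('a)) * (2 powr (- 2 * s)) ^ k)) \<noteq> top"
      by (intro ennreal_suminf_neq_top summable_mult) auto
    then show ?thesis by (simp add: less_top)
  qed
  finally show ?thesis .
qed

lemma nn_integral_lborel_product:
  fixes a :: "'a::euclidean_space \<Rightarrow> ennreal" and b :: "'b::euclidean_space \<Rightarrow> ennreal"
  assumes [measurable]: "a \<in> borel_measurable borel" "b \<in> borel_measurable borel"
  shows "(\<integral>\<^sup>+z. a (fst z) * b (snd z) \<partial>lborel) = (\<integral>\<^sup>+x. a x \<partial>lborel) * (\<integral>\<^sup>+y. b y \<partial>lborel)"
proof -
  have "(\<integral>\<^sup>+z. a (fst z) * b (snd z) \<partial>(lborel \<Otimes>\<^sub>M lborel)) = (\<integral>\<^sup>+x. \<integral>\<^sup>+y. a x * b y \<partial>lborel \<partial>lborel)"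
    by (subst lborel.nn_integral_fst[symmetric]) auto
  also have "\<dots> = (\<integral>\<^sup>+x. a x \<partial>lborel) * (\<integral>\<^sup>+y. b y \<partial>lborel)"
    by (simp add: nn_integral_cmult nn_integral_multc)
  finally show ?thesis by (simp add: lborel_prod)
qed

text \<open>Integrated over \<open>y \<in> \<Omega>\<close>, this bounds the values of \<open>v\<close> everywhere by its values on \<open>\<Omega>\<close> and the
interaction energy. It combines \<open>(v x)\<^sup>2 \<le> 2 * (v x - v y)\<^sup>2 + 2 * (v y)\<^sup>2\<close> with the fact that, for
\<open>y\<close> in a ball of radius \<open>R\<close>, the kernel decays no faster in \<open>x\<close> than a multiple of the weight.\<close>
lemma weight_pointwise:
  fixes v :: "'a::euclidean_space \<Rightarrow> real"
  assumes "0 < s" "1 \<le> R" "norm y \<le> R"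
  shows "(v x)\<^sup>2 * weight s x \<le>
    2 * (2 * R) powr (real DIM('a) + 2 * s) * (diff_quot s v (x, y))\<^sup>2 + 2 * (weight s x * (v y)\<^sup>2)"
proof -
  define p where "p = real DIM('a) + 2 * s"
  have p: "0 < p" using assms by (simp add: p_def add_nonneg_pos)
  have sq: "(v x)\<^sup>2 \<le> 2 * (v x - v y)\<^sup>2 + 2 * (v y)\<^sup>2"
  proof -
    have "0 \<le> (v x - 2 * v y)\<^sup>2" by simp
    then show ?thesis by (simp add: power2_eq_square algebra_simps)
  qed
  have dq: "(diff_quot s v (x, y))\<^sup>2 = (v x - v y)\<^sup>2 / norm (x - y) powr p"
    using diff_quot_mult[of s v x y v] by (simp add: p_def power2_eq_square)
  have main: "(v x - v y)\<^sup>2 * weight s x \<le> (2 * R) powr p * (diff_quot s v (x, y))\<^sup>2"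
  proof (cases "x = y")
    case False
    have "norm (x - y) \<le> norm x + R"
      using norm_triangle_ineq4[of x y] assms(3) by simp
    also have "\<dots> \<le> 2 * R * max 1 (norm x)"
    proof -
      have "norm x \<le> R * max 1 (norm x)"
        using assms(2) mult_mono[of 1 R "norm x" "max 1 (norm x)"] by simp
      moreover have "R \<le> R * max 1 (norm x)"
        using assms(2) mult_left_mono[of 1 "max 1 (norm x)" R] by simp
      ultimately show ?thesis by simp
    qed
    finally have "norm (x - y) powr p \<le> (2 * R * max 1 (norm x)) powr p"
      using p by (intro powr_mono2) auto
    also have "\<dots> = (2 * R) powr p * max 1 (norm x) powr p"
      using assms(2) by (simp add: powr_mult)
    also have "\<dots> \<le> (2 * R) powr p * (1 + norm x powr p)"
      by (intro mult_left_mono) (auto simp: max_def)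
    finally have "norm (x - y) powr p \<le> (2 * R) powr p / weight s x"
      by (simp add: weight_def p_def)
    then have "weight s x \<le> (2 * R) powr p / norm (x - y) powr p"
      using weight_pos[of s x] False by (simp add: field_simps)
    then have "(v x - v y)\<^sup>2 * weight s x \<le> (v x - v y)\<^sup>2 * ((2 * R) powr p / norm (x - y) powr p)"
      by (intro mult_left_mono) auto
    then show ?thesis by (simp add: dq mult.commute)
  qed simp
  have "(v x)\<^sup>2 * weight s x \<le> (2 * (v x - v y)\<^sup>2 + 2 * (v y)\<^sup>2) * weight s x"
    using sq weight_pos[of s x] by (intro mult_right_mono) auto
  also have "\<dots> = 2 * ((v x - v y)\<^sup>2 * weight s x) + 2 * (weight s x * (v y)\<^sup>2)"
    by (simp add: algebra_simps)
  finally show ?thesis using main by (simp add: p_def)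
qed

text \<open>For \<open>y \<in> \<Omega>\<close> every pair \<open>(x, y)\<close> lies
in the interaction region, so the pointwise bound can be integrated over all \<open>x\<close> and all \<open>y \<in> \<Omega>\<close>;
the left side then carries the factor \<open>|\<Omega>| > 0\<close>, and the right side is finite because the weight is
integrable.\<close>
lemma weighted_L2_bound:
  fixes \<Omega> :: "'a::euclidean_space set"
  assumes s: "0 < s" "s < 1" and \<Omega>: "open \<Omega>" "bounded \<Omega>" "\<Omega> \<noteq> {}"
  obtains C where "0 < C"
    "\<And>v. v \<in> V_space \<Omega> s \<Longrightarrow> (\<integral>\<^sup>+x. ennreal ((v x)\<^sup>2 * weight s x) \<partial>lebesgue) \<le>
       ennreal (C * (L2_inner \<Omega> v v + L2_inner (interaction_region \<Omega>) (diff_quot s v) (diff_quot s v)))"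
proof -
  obtain R0 where "\<And>y. y \<in> \<Omega> \<Longrightarrow> norm y \<le> R0" using \<Omega>(2) bounded_iff[of \<Omega>] by metis
  then obtain R where R: "1 \<le> R" "\<And>y. y \<in> \<Omega> \<Longrightarrow> norm y \<le> R"
    by (metis max.cobounded1 max.coboundedI2 max.commute)
  define B where "B = (2 * R) powr (real DIM('a) + 2 * s)"
  have B: "0 \<le> B" by (simp add: B_def)
  obtain W where W: "0 \<le> W" "(\<integral>\<^sup>+x. ennreal (weight s (x::'a)) \<partial>lborel) = ennreal W"
    using nn_integral_weight_finite[OF s(1), where 'a='a] by (auto simp: less_top_ennreal)
  have [measurable]: "\<Omega> \<in> sets borel" using \<Omega> by simp
  define m where "m = measure lborel \<Omega>"
  have fin: "emeasure lborel \<Omega> = ennreal m"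
    using emeasure_bounded_finite[OF \<Omega>(2)] unfolding m_def by (intro emeasure_eq_ennreal_measure) auto
  have "\<not> negligible \<Omega>" using open_not_negligible[OF \<Omega>(1,3)] .
  then have "emeasure lborel \<Omega> \<noteq> 0"
    by (auto simp: negligible_iff_null_sets null_sets_def)
  then have m: "0 < m" using fin by (cases "m \<le> 0") (auto simp: ennreal_neg)
  define C where "C = (2 * B + 2 * W + 1) / m"
  have C: "0 < C" using m B W by (simp add: C_def)
  show thesis
  proof (rule that[OF C])
    fix v assume vV: "v \<in> V_space \<Omega> s"
    let ?D = "interaction_region \<Omega>"
    have v: "v \<in> borel_measurable lebesgue" "v \<in> L2_space \<Omega>" "diff_quot s v \<in> L2_space ?D"
      using vV by (auto simp: V_space_iff[OF s])
    obtain w where w[measurable]: "w \<in> borel_measurable borel" and vw: "AE x in lebesgue. v x = w x"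
      using borel_representative[OF v(1)] .
    have [measurable]: "?D \<in> sets borel" by (rule sets_interaction_region)
    note [measurable] = diff_quot_measurable_borel[OF w, of s]
    define I where "I = (\<integral>\<^sup>+x. ennreal ((w x)\<^sup>2 * weight s x) \<partial>lborel)"
    define Q where "Q = L2_inner ?D (diff_quot s v) (diff_quot s v)"
    define P where "P = L2_inner \<Omega> v v"
    have QP: "0 \<le> Q" "0 \<le> P" by (auto simp: Q_def P_def L2_inner_self_nonneg)
    have I: "(\<integral>\<^sup>+x. ennreal ((v x)\<^sup>2 * weight s x) \<partial>lebesgue) = I"
      unfolding I_def nn_integral_completion using vw
      by (intro nn_integral_cong_AE) (auto simp: AE_completion_iff)
    have P: "(\<integral>\<^sup>+y. ennreal ((w y)\<^sup>2) * indicator \<Omega> y \<partial>lborel) = ennreal P"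
    proof -
      have "ennreal P = (\<integral>\<^sup>+x. ennreal ((v x)\<^sup>2) * indicator \<Omega> x \<partial>lborel)"
        unfolding P_def nn_integral_square_L2[OF v(2), symmetric]
        by (subst nn_integral_restrict_space) (auto simp: nn_integral_completion)
      also have "\<dots> = (\<integral>\<^sup>+y. ennreal ((w y)\<^sup>2) * indicator \<Omega> y \<partial>lborel)"
        using vw by (intro nn_integral_cong_AE) (auto simp: AE_completion_iff)
      finally show ?thesis ..
    qed
    have Q: "(\<integral>\<^sup>+z. ennreal ((diff_quot s w z)\<^sup>2) * indicator ?D z \<partial>lborel) = ennreal Q"
    proof -
      have "ennreal Q = (\<integral>\<^sup>+z. ennreal ((diff_quot s v z)\<^sup>2) * indicator ?D z \<partial>lborel)"
        unfolding Q_def nn_integral_square_L2[OF v(3), symmetric]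
        by (subst nn_integral_restrict_space) (auto simp: nn_integral_completion)
      also have "\<dots> = (\<integral>\<^sup>+z. ennreal ((diff_quot s w z)\<^sup>2) * indicator ?D z \<partial>lborel)"
        using diff_quot_cong_AE[OF vw, of s] by (intro nn_integral_cong_AE) (auto simp: AE_completion_iff)
      finally show ?thesis ..
    qed
    have "I * ennreal m = (\<integral>\<^sup>+z. ennreal ((w (fst z))\<^sup>2 * weight s (fst z)) * indicator \<Omega> (snd z) \<partial>(lborel :: ('a \<times> 'a) measure))"
      by (subst nn_integral_lborel_product) (auto simp: I_def fin)
    also have "\<dots> \<le> (\<integral>\<^sup>+z. ennreal (2 * B) * (ennreal ((diff_quot s w z)\<^sup>2) * indicator ?D z)
        + ennreal 2 * (ennreal (weight s (fst z)) * (ennreal ((w (snd z))\<^sup>2) * indicator \<Omega> (snd z))) \<partial>lborel)"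
    proof (intro nn_integral_mono)
      fix z :: "'a \<times> 'a"
      obtain x y where z: "z = (x, y)" by force
      show "ennreal ((w (fst z))\<^sup>2 * weight s (fst z)) * indicator \<Omega> (snd z) \<le>
         ennreal (2 * B) * (ennreal ((diff_quot s w z)\<^sup>2) * indicator ?D z)
        + ennreal 2 * (ennreal (weight s (fst z)) * (ennreal ((w (snd z))\<^sup>2) * indicator \<Omega> (snd z)))"
      proof (cases "y \<in> \<Omega>")
        case True
        then have D: "z \<in> ?D" using closure_subset[of \<Omega>] by (auto simp: z interaction_region_def exterior_def)
        have "ennreal ((w x)\<^sup>2 * weight s x)
            \<le> ennreal (2 * B * (diff_quot s w z)\<^sup>2 + 2 * (weight s x * (w y)\<^sup>2))"
          using weight_pointwise[OF s(1) R(1) R(2)[OF True], of w x]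
          by (intro ennreal_leI) (simp add: z B_def)
        also have "\<dots> = ennreal (2 * B) * ennreal ((diff_quot s w z)\<^sup>2)
            + ennreal 2 * (ennreal (weight s x) * ennreal ((w y)\<^sup>2))"
          using B weight_pos[of s x]
          by (subst ennreal_plus) (simp_all only: ennreal_mult'[symmetric] ennreal_mult''[symmetric] zero_le_power2 mult_nonneg_nonneg less_imp_le zero_le_numeral)
        finally show ?thesis
          using True D by (simp add: z)
      qed (simp add: z)
    qed
    also have "\<dots> = ennreal (2 * B) * ennreal Q + ennreal 2 * (ennreal W * ennreal P)"
    proof -
      have [measurable]: "(\<lambda>z. ennreal (weight s (fst z)) * (ennreal ((w (snd z))\<^sup>2) * indicator \<Omega> (snd z)))
          \<in> borel_measurable (borel :: ('a \<times> 'a) measure)"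
        unfolding borel_prod[symmetric] by measurable
      have "(\<integral>\<^sup>+z. ennreal (weight s (fst z)) * (ennreal ((w (snd z))\<^sup>2) * indicator \<Omega> (snd z)) \<partial>(lborel :: ('a \<times> 'a) measure))
        = ennreal W * ennreal P"
        by (subst nn_integral_lborel_product[where b="\<lambda>y. ennreal ((w y)\<^sup>2) * indicator \<Omega> y"]) (auto simp: W P)
      then show ?thesis
        by (subst nn_integral_add) (auto simp: nn_integral_cmult Q)
    qed
    also have "\<dots> = ennreal (2 * B * Q + 2 * W * P)"
      using B W QP by (subst ennreal_plus) (simp_all only: ennreal_mult'[symmetric] mult.assoc mult_nonneg_nonneg zero_le_numeral)
    also have "\<dots> \<le> ennreal (C * (P + Q) * m)"
    proof (intro ennreal_leI)
      have "2 * B * Q + 2 * W * P \<le> (2 * B + 2 * W + 1) * (P + Q)"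
        using B W QP by (simp add: algebra_simps)
      also have "\<dots> = C * (P + Q) * m" using m by (simp add: C_def)
      finally show "2 * B * Q + 2 * W * P \<le> C * (P + Q) * m" .
    qed
    also have "\<dots> = ennreal (C * (P + Q)) * ennreal m"
      using m by (simp add: ennreal_mult'')
    finally have "ennreal m * I \<le> ennreal m * ennreal (C * (P + Q))"
      by (simp only: mult.commute)
    then have "I \<le> ennreal (C * (P + Q))"
      using m by (subst (asm) ennreal_mult_le_mult_iff) auto
    then show "(\<integral>\<^sup>+x. ennreal ((v x)\<^sup>2 * weight s x) \<partial>lebesgue) \<le>
       ennreal (C * (L2_inner \<Omega> v v + L2_inner ?D (diff_quot s v) (diff_quot s v)))"
      by (simp add: I P_def Q_def)
  qed
qed

section \<open>The energy form and completeness\<close>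

definition energy ::
  "'a::euclidean_space set \<Rightarrow> real \<Rightarrow> real \<Rightarrow> ('a \<Rightarrow> real) \<Rightarrow> ('a \<Rightarrow> real) \<Rightarrow> real" where
  "energy \<Omega> s \<alpha> u v = X_inner \<Omega> s u v + \<alpha> * L2_inner \<Omega> u v"

lemma V_space_lincomb:
  assumes "0 < s" "s < 1" "u \<in> V_space \<Omega> s" "v \<in> V_space \<Omega> s"
  shows "(\<lambda>x. u x + c * v x) \<in> V_space \<Omega> s"
  using assms by (auto simp: V_space_iff diff_quot_lincomb L2_space_lincomb)

lemma V_space_diff:
  assumes "0 < s" "s < 1" "u \<in> V_space \<Omega> s" "v \<in> V_space \<Omega> s"
  shows "(\<lambda>x. u x - v x) \<in> V_space \<Omega> s"
  using V_space_lincomb[OF assms, of "-1"] by simp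

lemma energy_commute: "energy \<Omega> s \<alpha> u v = energy \<Omega> s \<alpha> v u"
  by (simp add: energy_def X_inner_eq L2_inner_commute)

lemma energy_linear:
  assumes s: "0 < s" "s < 1" and "u \<in> V_space \<Omega> s" "v \<in> V_space \<Omega> s" "w \<in> V_space \<Omega> s"
  shows "energy \<Omega> s \<alpha> (\<lambda>x. u x + c * v x) w = energy \<Omega> s \<alpha> u w + c * energy \<Omega> s \<alpha> v w"
  using assms(3-5)
  by (simp add: energy_def X_inner_eq V_space_iff[OF s] diff_quot_lincomb L2_inner_linear algebra_simps)

lemma weighted_energy_bound:
  fixes \<Omega> :: "'a::euclidean_space set"
  assumes s: "0 < s" "s < 1" and "0 < \<alpha>" and \<Omega>: "open \<Omega>" "bounded \<Omega>" "\<Omega> \<noteq> {}"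
  obtains K where "0 < K"
    "\<And>v. v \<in> V_space \<Omega> s \<Longrightarrow>
       (\<integral>\<^sup>+x. ennreal ((v x)\<^sup>2 * weight s x) \<partial>lebesgue) \<le> ennreal (K * energy \<Omega> s \<alpha> v v)"
proof -
  obtain C where C: "0 < C"
    "\<And>v. v \<in> V_space \<Omega> s \<Longrightarrow> (\<integral>\<^sup>+x. ennreal ((v x)\<^sup>2 * weight s x) \<partial>lebesgue) \<le>
       ennreal (C * (L2_inner \<Omega> v v + L2_inner (interaction_region \<Omega>) (diff_quot s v) (diff_quot s v)))"
    using weighted_L2_bound[OF s \<Omega>] by blast
  define \<kappa> where "\<kappa> = min \<alpha> (frac_const DIM('a) s / 2)"
  have \<kappa>: "0 < \<kappa>" using \<open>0 < \<alpha>\<close> frac_const_pos[OF s] by (simp add: \<kappa>_def)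
  show thesis
  proof (rule that[of "C / \<kappa>"])
    show "0 < C / \<kappa>" using C \<kappa> by simp
    fix v assume v: "v \<in> V_space \<Omega> s"
    let ?P = "L2_inner \<Omega> v v"
    let ?Q = "L2_inner (interaction_region \<Omega>) (diff_quot s v) (diff_quot s v)"
    have "\<kappa> * ?P + \<kappa> * ?Q \<le> \<alpha> * ?P + frac_const DIM('a) s / 2 * ?Q"
      by (intro add_mono mult_right_mono L2_inner_self_nonneg) (auto simp: \<kappa>_def)
    then have "?P + ?Q \<le> energy \<Omega> s \<alpha> v v / \<kappa>"
      using \<kappa> by (simp add: energy_def X_inner_eq field_simps)
    then have "C * (?P + ?Q) \<le> C / \<kappa> * energy \<Omega> s \<alpha> v v"
      using C(1) mult_left_mono[of "?P + ?Q" "energy \<Omega> s \<alpha> v v / \<kappa>" C] by simp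
    then show "(\<integral>\<^sup>+x. ennreal ((v x)\<^sup>2 * weight s x) \<partial>lebesgue) \<le> ennreal (C / \<kappa> * energy \<Omega> s \<alpha> v v)"
      using C(2)[OF v] by (meson ennreal_leI order_trans)
  qed
qed

lemma energy_nonneg:
  assumes "0 < s" "s < 1" "0 < \<alpha>"
  shows "0 \<le> energy \<Omega> s \<alpha> v v"
  using frac_const_pos[OF assms(1,2)] assms(3)
  by (auto simp: energy_def X_inner_eq L2_inner_self_nonneg less_imp_le)

text \<open>Each term of a convergent series of nonnegative terms is at most its sum \<open>M\<close>, so the increments are
at most \<open>sqrt (M / w) * (1/2) ^ k\<close> and hence summable.\<close>
lemma convergent_if_geometric_steps:
  fixes y :: "nat \<Rightarrow> real"
  assumes "0 < w" and "(\<Sum>k. ennreal (4 ^ k * ((y (Suc k) - y k)\<^sup>2 * w))) \<noteq> \<infinity>"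
  shows "convergent y"
proof -
  define M where "M = enn2real (\<Sum>k. ennreal (4 ^ k * ((y (Suc k) - y k)\<^sup>2 * w)))"
  have M: "(\<Sum>k. ennreal (4 ^ k * ((y (Suc k) - y k)\<^sup>2 * w))) = ennreal M" "0 \<le> M"
    using assms(2) by (auto simp: M_def less_top)
  have step: "\<bar>y (Suc k) - y k\<bar> \<le> sqrt (M / w) * (1/2) ^ k" for k
  proof -
    have "ennreal (4 ^ k * ((y (Suc k) - y k)\<^sup>2 * w)) \<le> ennreal M"
      using sum_le_suminf[of "\<lambda>k. ennreal (4 ^ k * ((y (Suc k) - y k)\<^sup>2 * w))" "{k}"]
      unfolding M(1) by simp
    then have "4 ^ k * ((y (Suc k) - y k)\<^sup>2 * w) \<le> M" using M(2) by simp
    then have "(2 ^ k * (y (Suc k) - y k))\<^sup>2 \<le> M / w"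
      using assms(1) by (simp add: pos_le_divide_eq power_mult_distrib mult.assoc power2_eq_square[of "2 ^ k"] power_mult_distrib[symmetric])
    then have "2 ^ k * \<bar>y (Suc k) - y k\<bar> \<le> sqrt (M / w)"
      using real_sqrt_le_mono[of "(2 ^ k * (y (Suc k) - y k))\<^sup>2" "M / w"] by (simp add: abs_mult)
    then show ?thesis by (simp add: power_one_over field_simps)
  qed
  have "summable (\<lambda>k. y (Suc k) - y k)"
    by (rule summable_comparison_test'[of "\<lambda>k. sqrt (M / w) * (1/2) ^ k" 0])
       (use step in \<open>auto intro!: summable_mult summable_geometric\<close>)
  then obtain L where "(\<lambda>n. \<Sum>k<n. y (Suc k) - y k) \<longlonglongrightarrow> L"
    unfolding summable_def sums_def by blast
  then have "(\<lambda>n. (\<Sum>k<n. y (Suc k) - y k) + y 0) \<longlonglongrightarrow> L + y 0"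
    by (intro tendsto_add tendsto_const)
  then show ?thesis
    unfolding sum_lessThan_telescope convergent_def by auto
qed

text \<open>Along a rapidly Cauchy subsequence the increments satisfy a weighted bound whose sum, with the
factors \<open>4 ^ k\<close>, is finite, so the subsequence converges at almost every point. The differences
\<open>X n - u\<close> are almost everywhere limits of elements of small energy and Fatou's lemma shows that
they have small energy themselves. In particular \<open>u = X n - (X n - u)\<close> lies in the space.\<close>
lemma V_space_complete:
  fixes \<Omega> :: "'a::euclidean_space set"
  assumes s: "0 < s" "s < 1" and \<alpha>: "0 < \<alpha>" and \<Omega>: "open \<Omega>" "bounded \<Omega>" "\<Omega> \<noteq> {}"
    and X: "\<And>n. X n \<in> V_space \<Omega> s"
    and cauchy: "\<And>e. 0 < e \<Longrightarrow> \<exists>N. \<forall>m\<ge>N. \<forall>n\<ge>N.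
        energy \<Omega> s \<alpha> (\<lambda>x. X m x - X n x) (\<lambda>x. X m x - X n x) < e"
  shows "\<exists>u\<in>V_space \<Omega> s. (\<lambda>n. energy \<Omega> s \<alpha> (\<lambda>x. X n x - u x) (\<lambda>x. X n x - u x)) \<longlonglongrightarrow> 0"
proof -
  let ?D = "interaction_region \<Omega>"
  let ?E = "\<lambda>v. energy \<Omega> s \<alpha> v v"
  obtain K where K: "0 < K"
    "\<And>v. v \<in> V_space \<Omega> s \<Longrightarrow>
       (\<integral>\<^sup>+x. ennreal ((v x)\<^sup>2 * weight s x) \<partial>lebesgue) \<le> ennreal (K * ?E v)"
    using weighted_energy_bound[OF s \<alpha> \<Omega>] by blast
  have "\<forall>k. \<exists>N. \<forall>m\<ge>N. \<forall>n\<ge>N. ?E (\<lambda>x. X m x - X n x) < (1/8) ^ k"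
    using cauchy by simp
  then obtain N where N: "\<And>k m n. N k \<le> m \<Longrightarrow> N k \<le> n \<Longrightarrow> ?E (\<lambda>x. X m x - X n x) < (1/8) ^ k"
    by metis
  \<comment> \<open>The summand 1 makes \<open>r k\<close> tend to infinity, which is needed to use the Cauchy property along \<open>r\<close>.\<close>
  define r where "r k = (\<Sum>i\<le>k. N i + 1)" for k
  have r: "N k \<le> r k" "N k \<le> r (Suc k)" for k
  proof -
    show "N k \<le> r k"
      using member_le_sum[of k "{..k}" "\<lambda>i. N i + 1"] by (simp add: r_def)
    then show "N k \<le> r (Suc k)" by (simp add: r_def)
  qed
  have r_ge: "k \<le> r k" for k
    unfolding r_def by (induction k) auto
  define Y where "Y k = X (r k)" for k
  have YV: "Y k \<in> V_space \<Omega> s" for k by (simp add: Y_def X)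
  have X_meas: "v \<in> borel_measurable lebesgue" if "v \<in> V_space \<Omega> s" for v
    using that by (simp add: V_space_def)
  note [measurable] = X_meas[OF YV]
  have [measurable]: "weight s \<in> borel_measurable (lebesgue :: 'a measure)"
    by (intro measurable_completion) simp
  have ae_conv: "AE x in lebesgue. convergent (\<lambda>k. Y k x)"
  proof -
    have meas: "(\<lambda>x. \<Sum>k. ennreal (4 ^ k * ((Y (Suc k) x - Y k x)\<^sup>2 * weight s x)))
        \<in> borel_measurable lebesgue"
      by measurable
    have "(\<integral>\<^sup>+x. (\<Sum>k. ennreal (4 ^ k * ((Y (Suc k) x - Y k x)\<^sup>2 * weight s x))) \<partial>lebesgue)
        = (\<Sum>k. \<integral>\<^sup>+x. ennreal (4 ^ k * ((Y (Suc k) x - Y k x)\<^sup>2 * weight s x)) \<partial>lebesgue)"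
      by (intro nn_integral_suminf) measurable
    also have "\<dots> \<le> (\<Sum>k. ennreal (K * (1/2) ^ k))"
    proof (intro suminf_le allI summableI)
      fix k
      have "(\<integral>\<^sup>+x. ennreal (4 ^ k * ((Y (Suc k) x - Y k x)\<^sup>2 * weight s x)) \<partial>lebesgue)
          = ennreal (4 ^ k) * (\<integral>\<^sup>+x. ennreal ((Y (Suc k) x - Y k x)\<^sup>2 * weight s x) \<partial>lebesgue)"
        by (subst nn_integral_cmult[symmetric]) (auto simp: ennreal_mult')
      also have "\<dots> \<le> ennreal (4 ^ k) * ennreal (K * ?E (\<lambda>x. Y (Suc k) x - Y k x))"
        by (intro mult_left_mono K(2) V_space_diff[OF s] YV) auto
      also have "\<dots> \<le> ennreal (4 ^ k) * ennreal (K * (1/8) ^ k)"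
        using N[OF r(2,1), of k] K(1) by (intro mult_left_mono ennreal_leI) (auto simp: Y_def)
      also have "\<dots> = ennreal (K * (1/2) ^ k)"
        by (simp add: ennreal_mult'[symmetric] power_mult_distrib[symmetric] mult.left_commute[of _ K])
      finally show "(\<integral>\<^sup>+x. ennreal (4 ^ k * ((Y (Suc k) x - Y k x)\<^sup>2 * weight s x)) \<partial>lebesgue)
          \<le> ennreal (K * (1/2) ^ k)" .
    qed
    also have "\<dots> < \<infinity>"
    proof -
      have "(\<Sum>k. ennreal (K * (1/2) ^ k)) \<noteq> top"
        using K(1) by (intro ennreal_suminf_neq_top summable_mult summable_geometric) auto
      then show ?thesis by (simp add: less_top)
    qed
    finally have "AE x in lebesgue. (\<Sum>k. ennreal (4 ^ k * ((Y (Suc k) x - Y k x)\<^sup>2 * weight s x))) \<noteq> \<infinity>"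
      by (intro nn_integral_PInf_AE meas) auto
    then show ?thesis
      by eventually_elim (rule convergent_if_geometric_steps[OF weight_pos])
  qed
  define u where "u x = lim (\<lambda>k. Y k x)" for x
  have u_meas: "u \<in> borel_measurable lebesgue"
    unfolding u_def by (rule borel_measurable_lim_metric) measurable
  have ae_lim: "AE x in lebesgue. (\<lambda>k. Y k x) \<longlonglongrightarrow> u x"
    using ae_conv by eventually_elim (simp add: u_def convergent_LIMSEQ_iff)
  have \<Omega>_sets: "\<Omega> \<in> sets lebesgue" "?D \<in> sets lebesgue"
    using \<Omega>(1) sets_interaction_region[of \<Omega>] by (auto intro!: sets_completionI_sets)
  have c: "0 < frac_const DIM('a) s" by (rule frac_const_pos[OF s])
  have limit: "(\<lambda>x. X n x - u x) \<in> V_space \<Omega> s \<and> ?E (\<lambda>x. X n x - u x) \<le> 2 * e"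
    if e: "\<And>m. N0 \<le> m \<Longrightarrow> ?E (\<lambda>x. X n x - X m x) < e" for n N0 e
  proof -
    have diffV: "(\<lambda>x. X n x - Y k x) \<in> V_space \<Omega> s" for k
      by (rule V_space_diff[OF s X YV])
    have parts: "L2_inner \<Omega> (\<lambda>x. X n x - Y k x) (\<lambda>x. X n x - Y k x) \<le> e / \<alpha>"
      "L2_inner ?D (diff_quot s (\<lambda>x. X n x - Y k x)) (diff_quot s (\<lambda>x. X n x - Y k x))
          \<le> e / (frac_const DIM('a) s / 2)" if "N0 \<le> k" for k
    proof -
      have "N0 \<le> r k" using r_ge[of k] that by simp
      from e[OF this] have "frac_const DIM('a) s / 2 *
          L2_inner ?D (diff_quot s (\<lambda>x. X n x - Y k x)) (diff_quot s (\<lambda>x. X n x - Y k x))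
          + \<alpha> * L2_inner \<Omega> (\<lambda>x. X n x - Y k x) (\<lambda>x. X n x - Y k x) < e"
        by (simp add: energy_def X_inner_eq Y_def)
      moreover have "0 \<le> frac_const DIM('a) s / 2 *
          L2_inner ?D (diff_quot s (\<lambda>x. X n x - Y k x)) (diff_quot s (\<lambda>x. X n x - Y k x))"
        "0 \<le> \<alpha> * L2_inner \<Omega> (\<lambda>x. X n x - Y k x) (\<lambda>x. X n x - Y k x)"
        using c \<alpha> by (simp_all add: L2_inner_self_nonneg)
      ultimately have
        "\<alpha> * L2_inner \<Omega> (\<lambda>x. X n x - Y k x) (\<lambda>x. X n x - Y k x) \<le> e"
        "frac_const DIM('a) s / 2 *
          L2_inner ?D (diff_quot s (\<lambda>x. X n x - Y k x)) (diff_quot s (\<lambda>x. X n x - Y k x)) \<le> e"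
        by simp_all
      then show "L2_inner \<Omega> (\<lambda>x. X n x - Y k x) (\<lambda>x. X n x - Y k x) \<le> e / \<alpha>"
        "L2_inner ?D (diff_quot s (\<lambda>x. X n x - Y k x)) (diff_quot s (\<lambda>x. X n x - Y k x))
          \<le> e / (frac_const DIM('a) s / 2)"
        using c \<alpha> by (simp_all only: pos_le_divide_eq mult.commute half_gt_zero)
    qed
    have meas: "(\<lambda>x. X n x - u x) \<in> borel_measurable lebesgue"
      using X_meas[OF X] u_meas by measurable
    have 1: "(\<lambda>x. X n x - u x) \<in> L2_space \<Omega>"
      "L2_inner \<Omega> (\<lambda>x. X n x - u x) (\<lambda>x. X n x - u x) \<le> e / \<alpha>"
    proof -
      have ae: "AE x in lebesgue_on \<Omega>. (\<lambda>k. X n x - Y k x) \<longlonglongrightarrow> X n x - u x"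
        using AE_lebesgue_onI[OF ae_lim \<Omega>_sets(1)] by eventually_elim (intro tendsto_intros)
      have L2: "\<And>k. (\<lambda>x. X n x - Y k x) \<in> L2_space \<Omega>"
        using diffV by (simp add: V_space_iff[OF s])
      note * = L2_fatou[OF L2 measurable_restrict_space1[OF meas] ae parts(1)]
      show "(\<lambda>x. X n x - u x) \<in> L2_space \<Omega>" by (rule *(1))
      show "L2_inner \<Omega> (\<lambda>x. X n x - u x) (\<lambda>x. X n x - u x) \<le> e / \<alpha>" by (rule *(2))
    qed
    have 2: "diff_quot s (\<lambda>x. X n x - u x) \<in> L2_space ?D"
      "L2_inner ?D (diff_quot s (\<lambda>x. X n x - u x)) (diff_quot s (\<lambda>x. X n x - u x))
        \<le> e / (frac_const DIM('a) s / 2)"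
    proof -
      have ae: "AE z in lebesgue_on ?D.
          (\<lambda>k. diff_quot s (\<lambda>x. X n x - Y k x) z) \<longlonglongrightarrow> diff_quot s (\<lambda>x. X n x - u x) z"
        using AE_lebesgue_onI[OF AE_lebesgue_fst_snd[OF ae_lim] \<Omega>_sets(2)]
      proof eventually_elim
        case (elim z)
        then show ?case
          unfolding diff_quot_def case_prod_beta' divide_inverse by (intro tendsto_intros) auto
      qed
      have L2: "\<And>k. diff_quot s (\<lambda>x. X n x - Y k x) \<in> L2_space ?D"
        using diffV by (simp add: V_space_iff[OF s])
      note * = L2_fatou[OF L2 measurable_restrict_space1[OF diff_quot_measurable[OF meas]] ae parts(2)]
      show "diff_quot s (\<lambda>x. X n x - u x) \<in> L2_space ?D" by (rule *(1))
      show "L2_inner ?D (diff_quot s (\<lambda>x. X n x - u x)) (diff_quot s (\<lambda>x. X n x - u x))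
        \<le> e / (frac_const DIM('a) s / 2)" by (rule *(2))
    qed
    have "?E (\<lambda>x. X n x - u x) \<le> e + e"
      unfolding energy_def X_inner_eq using 1(2) 2(2) c \<alpha>
      by (intro add_mono) (simp_all only: pos_le_divide_eq mult.commute half_gt_zero)
    then show ?thesis
      using meas 1(1) 2(1) by (simp add: V_space_iff[OF s])
  qed
  obtain N1 where "\<And>m n. N1 \<le> m \<Longrightarrow> N1 \<le> n \<Longrightarrow> ?E (\<lambda>x. X m x - X n x) < 1"
    using cauchy[of 1] by auto
  then have "(\<lambda>x. X N1 x - u x) \<in> V_space \<Omega> s"
    using limit[of N1 N1 1] by simp
  then have uV: "u \<in> V_space \<Omega> s"
    using V_space_diff[OF s X[of N1]] by fastforce
  have "(\<lambda>n. ?E (\<lambda>x. X n x - u x)) \<longlonglongrightarrow> 0"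
  proof (rule LIMSEQ_I)
    fix e :: real assume "0 < e"
    then obtain N0 where N0: "\<And>m n. N0 \<le> m \<Longrightarrow> N0 \<le> n \<Longrightarrow> ?E (\<lambda>x. X m x - X n x) < e / 3"
      using cauchy[of "e / 3"] by auto
    have "norm (?E (\<lambda>x. X n x - u x) - 0) < e" if "N0 \<le> n" for n
      using limit[of N0 n "e / 3"] N0[OF that] energy_nonneg[OF s \<alpha>, of \<Omega> "\<lambda>x. X n x - u x"] \<open>0 < e\<close>
      by simp
    then show "\<exists>N0. \<forall>n\<ge>N0. norm (?E (\<lambda>x. X n x - u x) - 0) < e" by blast
  qed
  with uV show ?thesis by blast
qed

section \<open>Existence and uniqueness\<close>

lemma constant_in_V_space:
  fixes \<Omega> :: "'a::euclidean_space set"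
  assumes s: "0 < s" "s < 1" and \<Omega>: "open \<Omega>" "bounded \<Omega>"
  shows "(\<lambda>x. c) \<in> V_space \<Omega> s"
proof -
  have "\<Omega> \<in> lmeasurable" using \<Omega> by (rule lmeasurable_open[rotated])
  then have "integrable (lebesgue_on \<Omega>) (\<lambda>x. c\<^sup>2)"
    by (intro finite_measure.integrable_const finite_measure_lebesgue_on)
  moreover have "diff_quot s (\<lambda>x::'a. c) = (\<lambda>z. 0)"
    by (auto simp: diff_quot_def)
  ultimately show ?thesis
    by (simp add: V_space_iff[OF s] L2_space_def)
qed

text \<open>With \<open>b = 1 / weight s x\<close>, this integrates \<open>|g v| \<le> g\<^sup>2 b + v\<^sup>2 / b\<close>: the weights of the data and of
the estimate for the energy space are reciprocal.\<close>
lemma source_in_dual: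
  fixes A :: "'a::euclidean_space set" and g v :: "'a \<Rightarrow> real"
  assumes g: "g \<in> L2s_dual A s" and A: "A \<in> sets lebesgue"
    and v: "v \<in> borel_measurable lebesgue"
    and fin: "(\<integral>\<^sup>+x. ennreal ((v x)\<^sup>2 * weight s x) \<partial>lebesgue) \<le> ennreal M" "0 \<le> M"
  shows "integrable (lebesgue_on A) (\<lambda>x. g x * v x)"
    and "\<bar>L2_inner A g v\<bar> \<le> (\<integral>x. (g x)\<^sup>2 * (1 + norm x powr (real DIM('a) + 2 * s)) \<partial>lebesgue_on A) + M"
proof -
  have [measurable]: "weight s \<in> borel_measurable (lebesgue :: 'a measure)"
    by (intro measurable_completion) simp
  note [measurable] = v
  have gm: "g \<in> borel_measurable (lebesgue_on A)"
    and gi: "integrable (lebesgue_on A) (\<lambda>x. (g x)\<^sup>2 * (1 + norm x powr (real DIM('a) + 2 * s)))"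
    using g by (auto simp: L2s_dual_def)
  have vm: "v \<in> borel_measurable (lebesgue_on A)" using v by (rule measurable_restrict_space1)
  have wi: "integrable lebesgue (\<lambda>x. (v x)\<^sup>2 * weight s x)"
    using fin(1) le_less_trans[OF fin(1), of \<infinity>]
    by (intro integrableI_nonneg) (auto simp: weight_pos less_imp_le)
  have w_le: "(\<integral>x. (v x)\<^sup>2 * weight s x \<partial>lebesgue_on A) \<le> M"
  proof -
    have "(\<integral>x. (v x)\<^sup>2 * weight s x \<partial>lebesgue_on A) \<le> (\<integral>x. (v x)\<^sup>2 * weight s x \<partial>lebesgue)"
    proof -
      have nonneg: "0 \<le> (v x)\<^sup>2 * weight s x" for x
        using weight_pos[of s x] by simp
      have "integrable lebesgue (\<lambda>x. indicator A x *\<^sub>R ((v x)\<^sup>2 * weight s x))"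
        using A wi by (rule integrable_mult_indicator)
      moreover have "indicator A x *\<^sub>R ((v x)\<^sup>2 * weight s x) \<le> (v x)\<^sup>2 * weight s x" for x
        using nonneg[of x] by (cases "x \<in> A") auto
      ultimately show ?thesis
        using A wi by (subst integral_restrict_space) (auto intro!: integral_mono)
    qed
    also have "ennreal \<dots> \<le> ennreal M"
      using fin(1) by (subst nn_integral_eq_integral[symmetric, OF wi])
        (auto intro!: AE_I2 mult_nonneg_nonneg simp: weight_pos less_imp_le)
    then have "(\<integral>x. (v x)\<^sup>2 * weight s x \<partial>lebesgue) \<le> M" using fin(2) by simp
    finally show ?thesis .
  qed
  have wi_A: "integrable (lebesgue_on A) (\<lambda>x. (v x)\<^sup>2 * weight s x)"
    using A integrable_mult_indicator[OF A wi] by (subst integrable_restrict_space) auto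
  have pw: "\<bar>g x * v x\<bar> \<le> (g x)\<^sup>2 * (1 + norm x powr (real DIM('a) + 2 * s)) + (v x)\<^sup>2 * weight s x" for x
  proof -
    define b where "b = 1 + norm x powr (real DIM('a) + 2 * s)"
    have b: "0 < b" "weight s x = 1 / b" by (auto simp: b_def weight_def add_pos_nonneg)
    define c where "c = sqrt b"
    have c: "0 < c" "b = c * c" using b by (auto simp: c_def)
    have "\<bar>g x * v x\<bar> = \<bar>(g x * c) * (v x / c)\<bar>" using c by simp
    also have "\<dots> \<le> (g x * c)\<^sup>2 + (v x / c)\<^sup>2"
      by (rule abs_mult_le_sum_squares)
    also have "\<dots> = (g x)\<^sup>2 * b + (v x)\<^sup>2 * weight s x"
      unfolding b(2) c(2) by (simp add: power2_eq_square)
    finally show ?thesis by (simp add: b_def)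
  qed
  show int: "integrable (lebesgue_on A) (\<lambda>x. g x * v x)"
    by (rule Bochner_Integration.integrable_bound[OF Bochner_Integration.integrable_add[OF gi wi_A]])
      (use gm vm pw in \<open>auto intro!: borel_measurable_times order_trans[OF pw]\<close>)
  have "\<bar>L2_inner A g v\<bar> \<le> (\<integral>x. \<bar>g x * v x\<bar> \<partial>lebesgue_on A)"
    unfolding L2_inner_def by (rule integral_abs_bound)
  also have "\<dots> \<le> (\<integral>x. (g x)\<^sup>2 * (1 + norm x powr (real DIM('a) + 2 * s)) + (v x)\<^sup>2 * weight s x \<partial>lebesgue_on A)"
    using int gi wi_A pw by (intro integral_mono) auto
  also have "\<dots> = (\<integral>x. (g x)\<^sup>2 * (1 + norm x powr (real DIM('a) + 2 * s)) \<partial>lebesgue_on A)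
      + (\<integral>x. (v x)\<^sup>2 * weight s x \<partial>lebesgue_on A)"
    using gi wi_A by (rule Bochner_Integration.integral_add)
  finally show "\<bar>L2_inner A g v\<bar> \<le>
      (\<integral>x. (g x)\<^sup>2 * (1 + norm x powr (real DIM('a) + 2 * s)) \<partial>lebesgue_on A) + M"
    using w_le by simp
qed

lemma sets_exterior: "exterior \<Omega> \<in> sets lebesgue"
  unfolding exterior_def by (intro sets_completionI_sets) (simp add: borel_open open_Compl)

text \<open>Existence is the representation theorem for the energy form. If two solutions differ by \<open>d\<close>, testing
with \<open>d\<close> shows that it has energy zero, and the weighted estimate turns this into \<open>d = 0\<close> almost
everywhere on the whole space, not only on \<open>\<Omega>\<close>.\<close>
lemma weak_solution_exists_unique:
  fixes \<Omega> :: "'a::euclidean_space set"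
  assumes s: "0 < s" "s < 1" and \<alpha>: "0 < \<alpha>" and \<Omega>: "open \<Omega>" "bounded \<Omega>" "\<Omega> \<noteq> {}"
    and f: "f \<in> L2_space \<Omega>" and g: "g \<in> L2s_dual (exterior \<Omega>) s"
  shows "\<exists>u. weak_solution \<Omega> s \<alpha> f g u \<and>
     (\<forall>w. weak_solution \<Omega> s \<alpha> f g w \<longrightarrow> (AE x in lebesgue. w x = u x))"
proof -
  let ?V = "V_space \<Omega> s" and ?E = "energy \<Omega> s \<alpha>"
  define l where "l v = L2_inner \<Omega> f v + L2_inner (exterior \<Omega>) g v" for v
  obtain K where K: "0 < K"
    "\<And>v. v \<in> ?V \<Longrightarrow> (\<integral>\<^sup>+x. ennreal ((v x)\<^sup>2 * weight s x) \<partial>lebesgue) \<le> ennreal (K * ?E v v)"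
    using weighted_energy_bound[OF s \<alpha> \<Omega>] by blast
  note E_nonneg = energy_nonneg[OF s \<alpha>]
  have KE: "0 \<le> K * ?E v v" for v using K(1) E_nonneg[of \<Omega> v] by simp
  have meas: "v \<in> borel_measurable lebesgue" if "v \<in> ?V" for v
    using that by (simp add: V_space_def)
  note g_dual = source_in_dual[OF g sets_exterior meas K(2) KE]
  define G where "G = (\<integral>x. (g x)\<^sup>2 * (1 + norm x powr (real DIM('a) + 2 * s)) \<partial>lebesgue_on (exterior \<Omega>))"
  have G: "0 \<le> G" unfolding G_def by (intro integral_nonneg_AE) auto
  have "\<exists>u\<in>?V. \<forall>v\<in>?V. ?E u v = l v"
  proof (rule riesz_representation)
    show "?V \<noteq> {}" using constant_in_V_space[OF s \<Omega>(1,2)] by blast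
    show "(\<lambda>x. u x + c * v x) \<in> ?V" if "u \<in> ?V" "v \<in> ?V" for u v c
      using V_space_lincomb[OF s that] .
    show "?E u v = ?E v u" for u v by (rule energy_commute)
    show "?E (\<lambda>x. u x + c * v x) w = ?E u w + c * ?E v w" if "u \<in> ?V" "v \<in> ?V" "w \<in> ?V" for u v w c
      using energy_linear[OF s that] .
    show "0 \<le> ?E v v" for v by (rule E_nonneg)
    show "l (\<lambda>x. u x + c * v x) = l u + c * l v" if "u \<in> ?V" "v \<in> ?V" for u v c
    proof -
      have "L2_inner \<Omega> f (\<lambda>x. u x + c * v x) = L2_inner \<Omega> f u + c * L2_inner \<Omega> f v"
        using that f by (subst (1 2 3) L2_inner_commute) (auto simp: V_space_iff[OF s] intro!: L2_inner_linear)
      moreover have "L2_inner (exterior \<Omega>) g (\<lambda>x. u x + c * v x)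
          = L2_inner (exterior \<Omega>) g u + c * L2_inner (exterior \<Omega>) g v"
        using g_dual(1)[OF that(1) that(1)] g_dual(1)[OF that(2) that(2)]
        unfolding L2_inner_def by (simp add: algebra_simps)
      ultimately show ?thesis by (simp add: l_def algebra_simps)
    qed
    show "\<bar>l v\<bar> \<le> (L2_inner \<Omega> f f + G + 1 / \<alpha> + K) * (1 + ?E v v)" if "v \<in> ?V" for v
    proof -
      have "L2_inner \<Omega> v v \<le> ?E v v / \<alpha>"
        using \<alpha> frac_const_pos[OF s, of "DIM('a)"] L2_inner_self_nonneg[of "interaction_region \<Omega>" "diff_quot s v"]
        by (simp add: energy_def X_inner_eq field_simps)
      moreover have "\<bar>L2_inner \<Omega> f v\<bar> \<le> L2_inner \<Omega> f f + L2_inner \<Omega> v v"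
        using that f by (intro L2_inner_abs_le) (auto simp: V_space_iff[OF s])
      moreover have "\<bar>L2_inner (exterior \<Omega>) g v\<bar> \<le> G + K * ?E v v"
        using g_dual(2)[OF that that] by (simp add: G_def)
      ultimately have "\<bar>l v\<bar> \<le> (L2_inner \<Omega> f f + G) * 1 + (1 / \<alpha> + K) * ?E v v"
        by (simp add: l_def algebra_simps)
      also have "\<dots> \<le> (L2_inner \<Omega> f f + G + 1 / \<alpha> + K) * (1 + ?E v v)"
      proof -
        have "0 \<le> (L2_inner \<Omega> f f + G) * ?E v v" "0 \<le> 1 / \<alpha> + K"
          using G K(1) \<alpha> E_nonneg[of \<Omega> v] L2_inner_self_nonneg[of \<Omega> f] by simp_all
        then show ?thesis by (simp add: algebra_simps)
      qed
      finally show ?thesis .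
    qed
  qed (rule V_space_complete[OF s \<alpha> \<Omega>])
  then obtain u where u: "u \<in> ?V" "\<And>v. v \<in> ?V \<Longrightarrow> ?E u v = l v" by blast
  have "AE x in lebesgue. w x = u x" if w: "weak_solution \<Omega> s \<alpha> f g w" for w
  proof -
    have wV: "w \<in> ?V" and wl: "\<And>v. v \<in> ?V \<Longrightarrow> ?E w v = l v"
      using w by (auto simp: weak_solution_def energy_def l_def)
    define d where "d = (\<lambda>x. w x - u x)"
    have d: "d \<in> ?V" unfolding d_def by (rule V_space_diff[OF s wV u(1)])
    have "?E d d = ?E w d - ?E u d"
      using energy_linear[OF s wV u(1) d, of \<alpha> "-1"] by (simp add: d_def)
    then have "?E d d = 0" using u(2)[OF d] wl[OF d] by simp
    then have "(\<integral>\<^sup>+x. ennreal ((d x)\<^sup>2 * weight s x) \<partial>lebesgue) = 0"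
      using K(2)[OF d] by simp
    moreover have "(\<lambda>x. ennreal ((d x)\<^sup>2 * weight s x)) \<in> borel_measurable lebesgue"
    proof -
      have [measurable]: "weight s \<in> borel_measurable (lebesgue :: 'a measure)"
        by (intro measurable_completion) simp
      note [measurable] = meas[OF d]
      show ?thesis by measurable
    qed
    ultimately have "AE x in lebesgue. ennreal ((d x)\<^sup>2 * weight s x) = 0"
      by (simp add: nn_integral_0_iff_AE)
    then show ?thesis
    proof eventually_elim
      case (elim x)
      then have "(d x)\<^sup>2 * weight s x \<le> 0" by (simp add: ennreal_eq_0_iff)
      then have "d x = 0" using weight_pos[of s x] by (auto simp: mult_le_0_iff)
      then show ?case by (simp add: d_def)
    qed
  qed
  moreover have "weak_solution \<Omega> s \<alpha> f g u"
    using u by (simp add: weak_solution_def energy_def l_def)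
  ultimately show ?thesis by blast
qed

section \<open>The boundary of a Lipschitz domain\<close>

text \<open>The graph is the image of the hyperplane orthogonal to \<open>e\<close>, which is a null set, under the Lipschitz
map \<open>y \<mapsto> y + \<phi> y e\<close>.\<close>
lemma negligible_lipschitz_graph:
  fixes e :: "'a::euclidean_space"
  assumes e: "norm e = 1" and lip: "L-lipschitz_on {y. y \<bullet> e = 0} \<phi>"
  shows "negligible {x. \<phi> (x - (x \<bullet> e) *\<^sub>R e) = x \<bullet> e}"
proof -
  have ee: "e \<bullet> e = 1" using e by (simp add: dot_square_norm)
  have "negligible ((\<lambda>y. y + \<phi> y *\<^sub>R e) ` {y. y \<bullet> e = 0})"
  proof (rule negligible_locally_Lipschitz_image)
    have "e \<noteq> 0" using e by auto
    then show "negligible {y. y \<bullet> e = 0}"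
      using negligible_hyperplane[of e 0] by (simp add: inner_commute)
    fix x assume x: "x \<in> {y. y \<bullet> e = 0}"
    have "norm (y + \<phi> y *\<^sub>R e - (x + \<phi> x *\<^sub>R e)) \<le> (1 + L) * norm (y - x)" if "y \<in> {y. y \<bullet> e = 0}" for y
    proof -
      have "norm (y + \<phi> y *\<^sub>R e - (x + \<phi> x *\<^sub>R e)) = norm ((y - x) + (\<phi> y - \<phi> x) *\<^sub>R e)"
        by (simp add: algebra_simps)
      also have "\<dots> \<le> norm (y - x) + \<bar>\<phi> y - \<phi> x\<bar>"
        using norm_triangle_ineq[of "y - x" "(\<phi> y - \<phi> x) *\<^sub>R e"] e by simp
      also have "\<dots> \<le> norm (y - x) + L * norm (y - x)"
        using lipschitz_onD[OF lip that x] by (simp add: dist_norm)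
      finally show ?thesis by (simp add: algebra_simps)
    qed
    then show "\<exists>T B. open T \<and> x \<in> T \<and> (\<forall>y\<in>{y. y \<bullet> e = 0} \<inter> T.
        norm (y + \<phi> y *\<^sub>R e - (x + \<phi> x *\<^sub>R e)) \<le> B * norm (y - x))"
      by (intro exI[of _ UNIV] exI[of _ "1 + L"]) auto
  qed simp
  moreover have "{x. \<phi> (x - (x \<bullet> e) *\<^sub>R e) = x \<bullet> e} \<subseteq> (\<lambda>y. y + \<phi> y *\<^sub>R e) ` {y. y \<bullet> e = 0}"
  proof
    fix x assume "x \<in> {x. \<phi> (x - (x \<bullet> e) *\<^sub>R e) = x \<bullet> e}"
    then have "x = (x - (x \<bullet> e) *\<^sub>R e) + \<phi> (x - (x \<bullet> e) *\<^sub>R e) *\<^sub>R e" by simp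
    moreover have "(x - (x \<bullet> e) *\<^sub>R e) \<bullet> e = 0" by (simp add: inner_diff_left ee)
    ultimately show "x \<in> (\<lambda>y. y + \<phi> y *\<^sub>R e) ` {y. y \<bullet> e = 0}" by blast
  qed
  ultimately show ?thesis by (rule negligible_subset)
qed

text \<open>Near a boundary point the frontier lies on the graph: above the graph points belong to the open set
\<open>\<Omega>\<close>, and strictly below it they have a neighbourhood that misses \<open>\<Omega>\<close>.\<close>
lemma negligible_frontier_lipschitz_boundary:
  assumes "open \<Omega>" "lipschitz_boundary \<Omega>"
  shows "negligible (frontier \<Omega>)"
  unfolding locally_negligible_alt[of "frontier \<Omega>"]
proof
  fix p assume p: "p \<in> frontier \<Omega>"
  obtain r e \<phi> L where r: "0 < r" and e: "norm e = 1" and lip: "L-lipschitz_on {y. y \<bullet> e = 0} \<phi>"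
    and loc: "\<Omega> \<inter> ball p r = {x \<in> ball p r. \<phi> (x - (x \<bullet> e) *\<^sub>R e) < x \<bullet> e}"
    using assms(2) p unfolding lipschitz_boundary_def by blast
  define F where "F x = \<phi> (x - (x \<bullet> e) *\<^sub>R e) - x \<bullet> e" for x
  have ee: "e \<bullet> e = 1" using e by (simp add: dot_square_norm)
  have "continuous_on UNIV (\<lambda>x. \<phi> (x - (x \<bullet> e) *\<^sub>R e))"
    by (rule continuous_on_compose2[OF lipschitz_on_continuous_on[OF lip]])
       (auto intro!: continuous_intros simp: inner_diff_left ee)
  then have F: "continuous_on UNIV F"
    unfolding F_def by (intro continuous_intros)
  have "frontier \<Omega> \<inter> ball p r \<subseteq> {x. \<phi> (x - (x \<bullet> e) *\<^sub>R e) = x \<bullet> e}"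
  proof (rule subsetI, rule CollectI, rule ccontr)
    fix x assume x: "x \<in> frontier \<Omega> \<inter> ball p r" and "\<phi> (x - (x \<bullet> e) *\<^sub>R e) \<noteq> x \<bullet> e"
    then have "F x \<noteq> 0" by (simp add: F_def)
    then consider "F x < 0" | "0 < F x" by linarith
    then show False
    proof cases
      case 1
      then have "x \<in> \<Omega>" using loc x by (auto simp: F_def)
      then show False using x assms(1) by (auto simp: frontier_def interior_open)
    next
      case 2
      let ?U = "{y. 0 < F y} \<inter> ball p r"
      have "open ?U"
        using F by (intro open_Int open_Collect_less continuous_on_const) auto
      moreover have "x \<in> ?U" using 2 x by simp
      moreover have "?U \<inter> \<Omega> = {}"
      proof -
        have "F y < 0" if "y \<in> \<Omega> \<inter> ball p r" for y
          using that unfolding loc by (simp add: F_def)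
        then show ?thesis by force
      qed
      ultimately have "x \<notin> closure \<Omega>"
        using open_Int_closure_eq_empty[of ?U \<Omega>] by blast
      then show False using x by (simp add: frontier_def)
    qed
  qed
  then have "negligible (frontier \<Omega> \<inter> ball p r)"
    using negligible_lipschitz_graph[OF e lip] negligible_subset by blast
  moreover have "openin (top_of_set (frontier \<Omega>)) (frontier \<Omega> \<inter> ball p r)" by auto
  moreover have "p \<in> frontier \<Omega> \<inter> ball p r" using p r by simp
  ultimately show "\<exists>U. openin (top_of_set (frontier \<Omega>)) U \<and> p \<in> U \<and> negligible U" by blast
qed

section \<open>The equation far from the domain\<close>

text \<open>A pair of the interaction region with exactly one point in \<open>A \<subseteq> exterior \<Omega>\<close> has its other point in the
closure of \<open>\<Omega>\<close>, at distance at least 1, where the kernel is at most 1.\<close>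
lemma diff_quot_indicator_square_le:
  fixes \<Omega> :: "'a::euclidean_space set"
  assumes A: "A \<subseteq> exterior \<Omega>"
    and sep: "\<And>x y. x \<in> A \<Longrightarrow> y \<in> closure \<Omega> \<Longrightarrow> 1 \<le> norm (x - y)"
    and s: "0 < s" and z: "z \<in> interaction_region \<Omega>"
  shows "(diff_quot s (indicator A) z)\<^sup>2 \<le> indicator (A \<times> closure \<Omega> \<union> closure \<Omega> \<times> A) z"
proof -
  obtain x y where xy: "z = (x, y)" by force
  have sq: "(diff_quot s (indicator A) z)\<^sup>2 =
      (indicator A x - indicator A y)\<^sup>2 / norm (x - y) powr (real DIM('a) + 2 * s)"
    using diff_quot_mult[of s "indicator A" x y "indicator A"] by (simp add: xy power2_eq_square)
  have ge: "1 \<le> norm (x - y) powr (real DIM('a) + 2 * s)" if "1 \<le> norm (x - y)"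
    using that s by (intro ge_one_powr_ge_zero) auto
  consider "x \<in> A" "y \<notin> A" | "y \<in> A" "x \<notin> A" | "x \<in> A \<longleftrightarrow> y \<in> A" by blast
  then show ?thesis
  proof cases
    case 1
    then have y: "y \<in> closure \<Omega>" using A z by (auto simp: xy interaction_region_def exterior_def)
    then show ?thesis using 1 ge[OF sep[OF 1(1) y]] unfolding sq by (simp add: xy divide_le_eq)
  next
    case 2
    then have x: "x \<in> closure \<Omega>" using A z by (auto simp: xy interaction_region_def exterior_def)
    then show ?thesis using 2 ge sep[OF 2(1) x] unfolding sq by (simp add: xy divide_le_eq norm_minus_commute)
  next
    case 3
    then show ?thesis unfolding sq by (simp add: indicator_def)
  qed
qed

lemma indicator_in_V_space:
  fixes \<Omega> :: "'a::euclidean_space set"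
  assumes s: "0 < s" "s < 1" and \<Omega>: "open \<Omega>" "bounded \<Omega>"
    and A: "A \<in> sets borel" "bounded A" "A \<subseteq> exterior \<Omega>"
    and sep: "\<And>x y. x \<in> A \<Longrightarrow> y \<in> closure \<Omega> \<Longrightarrow> 1 \<le> norm (x - y)"
  shows "indicator A \<in> V_space \<Omega> s"
proof -
  let ?D = "interaction_region \<Omega>"
  let ?S = "A \<times> closure \<Omega> \<union> closure \<Omega> \<times> A"
  have ind[measurable]: "indicator A \<in> borel_measurable borel"
    using A(1) by simp
  have meas: "(indicator A :: 'a \<Rightarrow> real) \<in> borel_measurable lebesgue"
    using A(1) by (intro measurable_completion) simp
  have zero: "indicator A x = (0::real)" if "x \<in> \<Omega>" for x
    using that A(3) closure_subset[of \<Omega>] by (auto simp: exterior_def indicator_def)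
  have "(\<integral>\<^sup>+x. ennreal ((indicator A x)\<^sup>2) \<partial>lebesgue_on \<Omega>) = (\<integral>\<^sup>+x. 0 \<partial>lebesgue_on \<Omega>)"
    by (intro nn_integral_cong) (simp add: zero space_restrict_space)
  then have 1: "indicator A \<in> L2_space \<Omega>"
    using measurable_restrict_space1[OF meas] by (simp add: L2_space_iff)
  have S: "?S \<in> sets borel"
    using A(1) by (intro sets.Un) (auto simp: borel_prod[symmetric] intro!: pair_measureI)
  have bdd: "bounded ?S"
    using A(2) \<Omega>(2) by (auto intro!: bounded_Times bounded_closure)
  have "(\<integral>\<^sup>+z. ennreal ((diff_quot s (indicator A) z)\<^sup>2) \<partial>lebesgue_on ?D)
      \<le> (\<integral>\<^sup>+z. indicator ?S z \<partial>lebesgue)"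
  proof -
    have D: "?D \<inter> space lebesgue \<in> sets lebesgue"
      using sets_interaction_region[of \<Omega>] by (intro sets_completionI_sets) simp
    have "ennreal ((diff_quot s (indicator A) z)\<^sup>2) * indicator ?D z \<le> indicator ?S z" for z
    proof (cases "z \<in> ?D")
      case True
      then have "ennreal ((diff_quot s (indicator A) z)\<^sup>2) \<le> ennreal (indicator ?S z)"
        by (intro ennreal_leI diff_quot_indicator_square_le[OF A(3) sep s(1)])
      then show ?thesis using True by (simp only: ennreal_indicator indicator_simps mult_1_right)
    qed simp
    then show ?thesis
      unfolding nn_integral_restrict_space[OF D] by (rule nn_integral_mono)
  qed
  also have "\<dots> = emeasure lborel ?S"
    using S by (simp add: nn_integral_completion)
  also have "\<dots> < \<infinity>" using emeasure_bounded_finite[OF bdd] by simp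
  finally have "(\<integral>\<^sup>+z. ennreal ((diff_quot s (indicator A) z)\<^sup>2) \<partial>lebesgue_on ?D) < \<infinity>" .
  then have 2: "diff_quot s (indicator A) \<in> L2_space ?D"
    using measurable_restrict_space1[OF diff_quot_measurable[OF meas]] by (simp add: L2_space_iff)
  show ?thesis using meas 1 2 by (simp add: V_space_iff[OF s])
qed

text \<open>Its integral over \<open>y\<close> is the nonlocal normal derivative of \<open>u\<close> at the exterior point \<open>x\<close>, without
the factor \<open>frac_const\<close>. Integration is over the closure, because the interaction region excludes only
pairs of points of the open exterior.\<close>
definition flux_density ::
  "'a::euclidean_space set \<Rightarrow> real \<Rightarrow> ('a \<Rightarrow> real) \<Rightarrow> 'a \<Rightarrow> 'a \<Rightarrow> real" where
  "flux_density \<Omega> s u x y =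
     indicator (closure \<Omega>) y * ((u x - u y) / norm (x - y) powr (real DIM('a) + 2 * s))"

lemma flux_density_measurable:
  fixes u :: "'a::euclidean_space \<Rightarrow> real"
  assumes "u \<in> borel_measurable borel"
  shows "(\<lambda>(x, y). flux_density \<Omega> s u x y) \<in> borel_measurable (lborel \<Otimes>\<^sub>M lborel)"
proof -
  note [measurable] = assms
  have [measurable]: "closure \<Omega> \<in> sets borel" by simp
  show ?thesis unfolding flux_density_def by measurable
qed

text \<open>The integrand of the interaction form is the sum of \<open>F (x, y) = indicator A x * flux_density \<Omega> s u x y\<close>
and of its reflection \<open>F (y, x)\<close>. Both have the same integral, which cancels the factor \<open>1 / 2\<close> in
front of the form.\<close>
lemma X_inner_indicator:
  fixes \<Omega> :: "'a::euclidean_space set"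
  assumes s: "0 < s" "s < 1" and A: "A \<in> sets borel" "A \<subseteq> exterior \<Omega>"
    and u: "u \<in> borel_measurable borel" "u \<in> V_space \<Omega> s" and AV: "indicator A \<in> V_space \<Omega> s"
  shows "integrable (lborel \<Otimes>\<^sub>M lborel) (\<lambda>(x, y). indicator A x * flux_density \<Omega> s u x y)"
    and "X_inner \<Omega> s u (indicator A) = frac_const DIM('a) s *
           (\<integral>x. indicator A x * (\<integral>y. flux_density \<Omega> s u x y \<partial>lborel) \<partial>lborel)"
proof -
  let ?D = "interaction_region \<Omega>"
  define F where "F = (\<lambda>(x, y). indicator A x * flux_density \<Omega> s u x y)"
  define H where "H = (\<lambda>z. indicator ?D z *\<^sub>R (diff_quot s u z * diff_quot s (indicator A) z))"
  note [measurable] = u(1) A(1)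
  have Fm: "F \<in> borel_measurable (lborel \<Otimes>\<^sub>M lborel)"
    using flux_density_measurable[OF u(1), of \<Omega> s] unfolding F_def by measurable
  have D: "?D \<in> sets borel" by (rule sets_interaction_region)
  have DL: "?D \<inter> space lebesgue \<in> sets lebesgue" using D by (intro sets_completionI_sets) simp
  have Hi: "integrable lebesgue H"
    unfolding H_def
    using integrable_mult_L2[of "diff_quot s u" ?D "diff_quot s (indicator A)"] u(2) AV
    unfolding integrable_restrict_space[OF DL] by (simp add: V_space_iff[OF s])
  have split: "H (x, y) = F (x, y) + F (y, x)" for x y
  proof -
    have "A \<inter> closure \<Omega> = {}" using A(2) by (auto simp: exterior_def)
    then show ?thesis
      using A(2) unfolding H_def F_def flux_density_def diff_quot_mult
      by (auto simp: indicator_def interaction_region_def exterior_def norm_minus_commute[of x y]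
          minus_divide_left)
  qed
  have F_eq: "F z = indicator (A \<times> closure \<Omega>) z *\<^sub>R H z" for z
  proof -
    have "A \<inter> closure \<Omega> = {}" using A(2) by (auto simp: exterior_def)
    then show ?thesis
      using split[of "fst z" "snd z"] by (cases z) (auto simp: F_def flux_density_def indicator_def)
  qed
  have "A \<times> closure \<Omega> \<in> sets lebesgue"
    using A(1) by (intro sets_completionI_sets) (auto simp: borel_prod[symmetric] intro!: pair_measureI)
  then have "integrable lebesgue F"
    unfolding F_eq[abs_def] using Hi by (rule integrable_mult_indicator)
  moreover have Fb: "F \<in> borel_measurable lborel" using Fm by (simp add: lborel_prod)
  ultimately have Fi: "integrable (lborel \<Otimes>\<^sub>M lborel) F"
    by (simp add: integrable_completion lborel_prod)
  then show "integrable (lborel \<Otimes>\<^sub>M lborel) (\<lambda>(x, y). indicator A x * flux_density \<Omega> s u x y)"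
    by (simp add: F_def)
  have swap_i: "integrable (lborel \<Otimes>\<^sub>M lborel) (\<lambda>(x, y). F (y, x))"
    using Fi by (rule lborel_pair.integrable_product_swap)
  have swap: "(\<integral>(x, y). F (y, x) \<partial>(lborel \<Otimes>\<^sub>M lborel)) = integral\<^sup>L (lborel \<Otimes>\<^sub>M lborel) F"
    using Fm by (rule lborel_pair.integral_product_swap)
  have H_eq: "H = (\<lambda>z. F z + (case z of (x, y) \<Rightarrow> F (y, x)))"
    using split by (auto simp: fun_eq_iff)
  have Hb: "H \<in> borel_measurable lborel"
    unfolding H_eq lborel_prod[symmetric]
    using Fm swap_i by (intro borel_measurable_add) (auto dest: borel_measurable_integrable)
  have "L2_inner ?D (diff_quot s u) (diff_quot s (indicator A)) = integral\<^sup>L lebesgue H"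
    unfolding L2_inner_def H_def by (rule integral_restrict_space[OF DL])
  also have "\<dots> = integral\<^sup>L (lborel \<Otimes>\<^sub>M lborel) H"
    unfolding lborel_prod using Hb by (rule integral_completion)
  also have "\<dots> = 2 * integral\<^sup>L (lborel \<Otimes>\<^sub>M lborel) F"
    unfolding H_eq using Fi swap_i swap by simp
  also have "integral\<^sup>L (lborel \<Otimes>\<^sub>M lborel) F = (\<integral>x. (\<integral>y. F (x, y) \<partial>lborel) \<partial>lborel)"
    using lborel_pair.integral_fst'[OF Fi] by simp
  also have "\<dots> = (\<integral>x. indicator A x * (\<integral>y. flux_density \<Omega> s u x y \<partial>lborel) \<partial>lborel)"
    by (simp add: F_def)
  finally show "X_inner \<Omega> s u (indicator A) = frac_const DIM('a) s *
           (\<integral>x. indicator A x * (\<integral>y. flux_density \<Omega> s u x y \<partial>lborel) \<partial>lborel)"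
    by (simp add: X_inner_eq)
qed

text \<open>It suffices to test the sets where \<open>k\<close> is positive and where it is negative, cut off at radius \<open>n\<close>.\<close>
lemma AE_zero_if_bounded_set_integrals_zero:
  fixes k :: "'a::euclidean_space \<Rightarrow> real"
  assumes k: "k \<in> borel_measurable borel"
    and int: "\<And>A. A \<in> sets borel \<Longrightarrow> bounded A \<Longrightarrow> A \<subseteq> {x. r < norm x} \<Longrightarrow>
        integrable lborel (\<lambda>x. indicator A x * k x) \<and> (\<integral>x. indicator A x * k x \<partial>lborel) = 0"
  shows "AE x in lborel. r < norm x \<longrightarrow> k x = 0"
proof -
  note [measurable] = k
  have "AE x in lborel. \<not> (r < norm x \<and> norm x \<le> real n \<and> 0 < \<sigma> * k x)" if "\<bar>\<sigma>\<bar> = 1" for n and \<sigma> :: real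
  proof -
    define A where "A = {x. r < norm x \<and> norm x \<le> real n \<and> 0 < \<sigma> * k x}"
    have "A \<in> sets borel" unfolding A_def by measurable
    moreover have "bounded A" by (rule bounded_subset[of "cball 0 (real n)"]) (auto simp: A_def)
    moreover have "A \<subseteq> {x. r < norm x}" by (auto simp: A_def)
    ultimately have i: "integrable lborel (\<lambda>x. indicator A x * k x)" "(\<integral>x. indicator A x * k x \<partial>lborel) = 0"
      using int by auto
    have "integrable lborel (\<lambda>x. \<sigma> * (indicator A x * k x))" "(\<integral>x. \<sigma> * (indicator A x * k x) \<partial>lborel) = 0"
      using i by simp_all
    moreover have "0 \<le> \<sigma> * (indicator A x * k x)" for x
      by (auto simp: indicator_def A_def)
    ultimately have "AE x in lborel. \<sigma> * (indicator A x * k x) = 0"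
      using integral_nonneg_eq_0_iff_AE[of lborel "\<lambda>x. \<sigma> * (indicator A x * k x)"] by auto
    then show ?thesis
      by eventually_elim (auto simp: A_def indicator_def)
  qed
  from this[of 1] this[of "-1"]
  have "AE x in lborel. \<forall>n. \<not> (r < norm x \<and> norm x \<le> real n \<and> 0 < k x)"
    "AE x in lborel. \<forall>n. \<not> (r < norm x \<and> norm x \<le> real n \<and> 0 < - k x)"
    unfolding AE_all_countable by simp_all
  then show ?thesis
  proof eventually_elim
    case (elim x)
    obtain n where "norm x \<le> real n" using real_arch_simple by blast
    then show ?case using elim by (metis neg_0_less_iff_less not_less_iff_gr_or_eq)
  qed
qed

text \<open>The Euler equation at exterior points: testing with indicators of bounded sets leaves no
contribution from \<open>\<Omega>\<close>, and Fubini turns the interaction form into an integral of the flux. The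
distance 1 from the ball of radius \<open>R\<close> keeps the kernel bounded, so these indicators are admissible.\<close>
lemma exterior_equation:
  fixes \<Omega> :: "'a::euclidean_space set" and u g :: "'a \<Rightarrow> real"
  assumes s: "0 < s" "s < 1" and \<alpha>: "0 < \<alpha>" and \<Omega>: "open \<Omega>" "bounded \<Omega>" "\<Omega> \<noteq> {}"
    and g: "g \<in> L2s_dual (exterior \<Omega>) s"
    and u: "u \<in> borel_measurable borel" "weak_solution \<Omega> s \<alpha> f g u"
    and R: "closure \<Omega> \<subseteq> cball 0 R"
  shows "AE x in lebesgue. R + 1 < norm x \<longrightarrow>
           frac_const DIM('a) s * (\<integral>y. flux_density \<Omega> s u x y \<partial>lborel) = g x"
proof -
  let ?X = "exterior \<Omega>"
  define c where "c = frac_const DIM('a) s"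
  define h where "h x = c * (\<integral>y. flux_density \<Omega> s u x y \<partial>lborel)" for x
  have uV: "u \<in> V_space \<Omega> s" using u(2) by (simp add: weak_solution_def)
  have XL: "?X \<inter> space lebesgue \<in> sets lebesgue" using sets_exterior by simp
  have "(\<lambda>x. indicator ?X x *\<^sub>R g x) \<in> borel_measurable lebesgue"
    using g unfolding borel_measurable_restrict_space_iff[OF XL, symmetric] by (simp add: L2s_dual_def)
  then obtain G where G: "G \<in> borel_measurable borel" "AE x in lebesgue. indicator ?X x *\<^sub>R g x = G x"
    by (rule borel_representative)
  obtain K where K: "0 < K"
    "\<And>v. v \<in> V_space \<Omega> s \<Longrightarrow>
       (\<integral>\<^sup>+x. ennreal ((v x)\<^sup>2 * weight s x) \<partial>lebesgue) \<le> ennreal (K * energy \<Omega> s \<alpha> v v)"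
    using weighted_energy_bound[OF s \<alpha> \<Omega>] by blast
  note [measurable] = u(1) G(1)
  have h: "h \<in> borel_measurable borel"
  proof -
    have "(\<lambda>x. \<integral>y. flux_density \<Omega> s u x y \<partial>lborel) \<in> borel_measurable lborel"
      using flux_density_measurable[OF u(1), of \<Omega> s]
      by (rule lborel.borel_measurable_lebesgue_integral)
    then show ?thesis unfolding h_def by simp
  qed
  have Rn: "norm x \<le> R" if "x \<in> closure \<Omega>" for x
    using subsetD[OF R that] by simp
  have far: "x \<in> ?X" "1 \<le> norm (x - y)" if "R + 1 < norm x" "y \<in> closure \<Omega>" for x y
  proof -
    show "x \<in> ?X" using that(1) R by (auto simp: exterior_def)
    have "norm y \<le> R" using that(2) R by auto
    then show "1 \<le> norm (x - y)" using that(1) norm_triangle_ineq2[of x y] by linarith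
  qed
  have "AE x in lborel. R + 1 < norm x \<longrightarrow> h x - G x = 0"
  proof (rule AE_zero_if_bounded_set_integrals_zero)
    show "(\<lambda>x. h x - G x) \<in> borel_measurable borel" using h by measurable
    fix A :: "'a set" assume A: "A \<in> sets borel" "bounded A" "A \<subseteq> {x. R + 1 < norm x}"
    have AX: "A \<subseteq> ?X"
    proof
      fix x assume "x \<in> A"
      then have "R + 1 < norm x" using A(3) by blast
      then show "x \<in> ?X" using Rn[of x] by (auto simp: exterior_def)
    qed
    have AV: "indicator A \<in> V_space \<Omega> s"
      using A(3) far(2) by (intro indicator_in_V_space[OF s \<Omega>(1,2) A(1,2) AX]) auto
    have AO: "indicator A x = (0::real)" if "x \<in> \<Omega>" for x
      using that AX closure_subset[of \<Omega>] by (auto simp: exterior_def indicator_def)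
    have zero: "L2_inner \<Omega> v (indicator A) = 0" for v
      unfolding L2_inner_def by (rule integral_eq_zero_AE, rule AE_I2) (simp add: AO space_restrict_space)
    have weak: "X_inner \<Omega> s u (indicator A) = L2_inner ?X g (indicator A)"
    proof -
      have "X_inner \<Omega> s u (indicator A) + \<alpha> * L2_inner \<Omega> u (indicator A)
          = L2_inner \<Omega> f (indicator A) + L2_inner ?X g (indicator A)"
        using u(2) AV by (simp add: weak_solution_def)
      then show ?thesis by (simp add: zero)
    qed
    have flux: "integrable lborel (\<lambda>x. indicator A x * h x)"
      "X_inner \<Omega> s u (indicator A) = (\<integral>x. indicator A x * h x \<partial>lborel)"
    proof -
      note * = X_inner_indicator[OF s A(1) AX u(1) uV AV]
      have "integrable lborel (\<lambda>x. \<integral>y. indicator A x * flux_density \<Omega> s u x y \<partial>lborel)"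
        using lborel_pair.integrable_fst'[OF *(1)] by simp
      then have "integrable lborel (\<lambda>x. c * (indicator A x * (\<integral>y. flux_density \<Omega> s u x y \<partial>lborel)))"
        by simp
      then show "integrable lborel (\<lambda>x. indicator A x * h x)"
        by (simp add: h_def mult.left_commute)
      show "X_inner \<Omega> s u (indicator A) = (\<integral>x. indicator A x * h x \<partial>lborel)"
        unfolding *(2) h_def by (simp add: mult.left_commute[of "indicator A _"] c_def)
    qed
    have ae: "AE x in lebesgue. indicator ?X x *\<^sub>R (g x * indicator A x) = indicator A x * G x"
      using G(2) by eventually_elim (auto simp: mult.commute)
    have Gb: "(\<lambda>x. indicator A x * G x) \<in> borel_measurable lborel" using A(1) by simp
    have gi: "integrable lebesgue (\<lambda>x. indicator ?X x *\<^sub>R (g x * indicator A x))"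
    proof -
      have "integrable (lebesgue_on ?X) (\<lambda>x. g x * indicator A x)"
        using source_in_dual(1)[OF g sets_exterior _ K(2)[OF AV]] K(1) energy_nonneg[OF s \<alpha>, of \<Omega> "indicator A"] AV
        by (simp add: V_space_def)
      then show ?thesis unfolding integrable_restrict_space[OF XL] .
    qed
    have G_int: "integrable lborel (\<lambda>x. indicator A x * G x)"
      "L2_inner ?X g (indicator A) = (\<integral>x. indicator A x * G x \<partial>lborel)"
    proof -
      have Gl: "(\<lambda>x. indicator A x * G x) \<in> borel_measurable lebesgue"
        using Gb by (rule measurable_completion)
      have "integrable lebesgue (\<lambda>x. indicator A x * G x)"
        using integrable_cong_AE[OF borel_measurable_integrable[OF gi] Gl ae] gi by simp
      then show "integrable lborel (\<lambda>x. indicator A x * G x)"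
        using Gb by (simp add: integrable_completion)
      have "L2_inner ?X g (indicator A) = (\<integral>x. indicator A x * G x \<partial>lebesgue)"
        unfolding L2_inner_def integral_restrict_space[OF XL]
        by (rule integral_cong_AE[OF borel_measurable_integrable[OF gi] Gl ae])
      then show "L2_inner ?X g (indicator A) = (\<integral>x. indicator A x * G x \<partial>lborel)"
        using Gb by (simp add: integral_completion)
    qed
    show "integrable lborel (\<lambda>x. indicator A x * (h x - G x)) \<and>
        (\<integral>x. indicator A x * (h x - G x) \<partial>lborel) = 0"
      using flux G_int weak by (simp add: right_diff_distrib)
  qed
  then have "AE x in lebesgue. R + 1 < norm x \<longrightarrow> h x - G x = 0" by (rule AE_completion)
  with G(2) show ?thesis
  proof eventually_elim
    case (elim x)
    show ?case
    proof
      assume x: "R + 1 < norm x"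
      then have "x \<in> ?X" using R by (auto simp: exterior_def)
      then show "frac_const DIM('a) s * (\<integral>y. flux_density \<Omega> s u x y \<partial>lborel) = g x"
        using elim x by (simp add: h_def c_def)
    qed
  qed
qed

section \<open>The limit at infinity\<close>

lemma kernel_ratio_tendsto_one:
  fixes p R \<epsilon> :: real
  assumes "0 \<le> R" "0 < \<epsilon>"
  obtains r where "R < r"
    "\<And>x y :: 'a::real_normed_vector. r < norm x \<Longrightarrow> norm y \<le> R \<Longrightarrow>
       \<bar>(norm x / norm (x - y)) powr p - 1\<bar> \<le> \<epsilon>"
proof -
  have "((\<lambda>t::real. t powr p) \<longlongrightarrow> 1 powr p) (at 1)"
    by (intro tendsto_intros) auto
  then obtain \<eta> where \<eta>: "0 < \<eta>" "\<And>t::real. t \<noteq> 1 \<Longrightarrow> \<bar>t - 1\<bar> < \<eta> \<Longrightarrow> \<bar>t powr p - 1\<bar> < \<epsilon>"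
    using assms(2) unfolding LIM_eq by (auto simp: dist_norm)
  show thesis
  proof (rule that[of "R + R / \<eta> + 1"])
    show "R < R + R / \<eta> + 1" using assms \<eta> by (simp add: add_nonneg_pos)
    fix x y :: 'a assume x: "R + R / \<eta> + 1 < norm x" and y: "norm y \<le> R"
    have d: "R / \<eta> < norm (x - y)" using norm_triangle_ineq2[of x y] x y by linarith
    have pos: "0 < norm (x - y)" using d assms \<eta> by (meson divide_nonneg_pos le_less_trans)
    have "\<bar>norm x / norm (x - y) - 1\<bar> = \<bar>norm x - norm (x - y)\<bar> / norm (x - y)"
      using pos by (simp add: field_simps abs_divide[symmetric])
    also have "\<dots> \<le> R / norm (x - y)"
      using pos y norm_triangle_ineq3[of x "x - y"] by (intro divide_right_mono) auto
    also have "\<dots> < \<eta>"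
      using d pos \<eta> by (simp add: field_simps)
    finally have "\<bar>norm x / norm (x - y) - 1\<bar> < \<eta>" .
    then show "\<bar>(norm x / norm (x - y)) powr p - 1\<bar> \<le> \<epsilon>"
      using \<eta>(2)[of "norm x / norm (x - y)"] assms(2)
      by (cases "norm x / norm (x - y) = 1") auto
  qed
qed

text \<open>With \<open>\<rho> y = (norm x / norm (x - y)) powr p\<close>, multiplying the flux by \<open>norm x powr p\<close> gives
\<open>(u x - l) * (\<integral> \<rho>) - (\<integral> (u y - l) * \<rho> y)\<close> over the closure of \<open>\<Omega>\<close>. Since \<open>u - l\<close> has mean zero
there, \<open>\<rho>\<close> may be replaced by \<open>\<rho> - 1\<close> in the last integral, which is small; the factor
\<open>\<integral> \<rho>\<close> is at least \<open>m / 2\<close>.\<close>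
lemma deviation_from_mean_le:
  fixes \<Omega> :: "'a::euclidean_space set" and u :: "'a \<Rightarrow> real" and s :: real
  defines "p \<equiv> real DIM('a) + 2 * s" and "K \<equiv> closure \<Omega>"
  defines "m \<equiv> measure lborel K"
  defines "l \<equiv> (\<integral>y. indicator K y * u y \<partial>lborel) / m"
  assumes u: "u \<in> borel_measurable borel" "integrable lborel (\<lambda>y. indicator K y * u y)"
    and K: "bounded \<Omega>" "0 < m"
    and \<epsilon>: "\<epsilon> \<le> 1 / 2" and ratio: "\<And>y. y \<in> K \<Longrightarrow> \<bar>(norm x / norm (x - y)) powr p - 1\<bar> \<le> \<epsilon>"
  shows "\<bar>u x - l\<bar> \<le> 2 / m * (norm x powr p * \<bar>\<integral>y. flux_density \<Omega> s u x y \<partial>lborel\<bar>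
            + \<epsilon> * (\<integral>y. indicator K y * \<bar>u y - l\<bar> \<partial>lborel))"
proof -
  note [measurable] = u(1)
  have [measurable]: "K \<in> sets borel" by (simp add: K_def)
  define \<rho> where "\<rho> y = (norm x / norm (x - y)) powr p" for y
  have [measurable]: "\<rho> \<in> borel_measurable borel" unfolding \<rho>_def by measurable
  have K_int: "integrable lborel (\<lambda>y. indicator K y :: real)"
    using K(1) emeasure_bounded_finite[of K] by (intro integrable_real_indicator) (auto simp: K_def bounded_closure)
  have \<rho>: "\<bar>\<rho> y - 1\<bar> \<le> \<epsilon>" if "y \<in> K" for y using ratio[OF that] by (simp add: \<rho>_def)
  have dev: "integrable lborel (\<lambda>y. indicator K y * (u y - l))"
    using u(2) K_int by (simp add: right_diff_distrib)
  have dev0: "(\<integral>y. indicator K y * (u y - l) \<partial>lborel) = 0"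
  proof -
    have "(\<integral>y. indicator K y * (u y - l) \<partial>lborel) = (\<integral>y. indicator K y * u y \<partial>lborel) - m * l"
      using u(2) K_int by (simp add: right_diff_distrib m_def)
    then show ?thesis using K(2) by (simp add: l_def)
  qed
  have \<rho>_int: "integrable lborel (\<lambda>y. indicator K y * (\<rho> y - 1))"
    by (rule Bochner_Integration.integrable_bound[OF integrable_mult_right[OF K_int, of \<epsilon>]])
       (use \<rho> in \<open>auto simp: indicator_def intro: order_trans[OF _ abs_ge_self]\<close>)
  have dev\<rho>: "integrable lborel (\<lambda>y. indicator K y * (u y - l) * (\<rho> y - 1))"
  proof (rule Bochner_Integration.integrable_bound[OF integrable_mult_left[OF dev, of \<epsilon>]])
    have "\<bar>indicator K y * (u y - l) * (\<rho> y - 1)\<bar> \<le> \<bar>indicator K y * (u y - l) * \<epsilon>\<bar>" for y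
      unfolding abs_mult using \<rho>[of y] by (cases "y \<in> K") (auto intro!: mult_left_mono)
    then show "AE y in lborel. norm (indicator K y * (u y - l) * (\<rho> y - 1)) \<le> norm (indicator K y * (u y - l) * \<epsilon>)"
      by simp
  qed measurable
  have \<rho>_lower: "m / 2 \<le> (\<integral>y. indicator K y * \<rho> y \<partial>lborel)"
  proof -
    have "m / 2 = (\<integral>y. indicator K y * (1 / 2) \<partial>lborel)" by (simp add: m_def)
    also have "\<dots> \<le> (\<integral>y. indicator K y * (\<rho> y - 1) + indicator K y \<partial>lborel)"
      using K_int \<rho>_int
    proof (intro integral_mono)
      fix y show "indicator K y * (1 / 2) \<le> indicator K y * (\<rho> y - 1) + (indicator K y :: real)"
        using \<rho>[of y] \<epsilon> by (auto simp: indicator_def abs_le_iff)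
    qed auto
    also have "\<dots> = (\<integral>y. indicator K y * \<rho> y \<partial>lborel)"
      by (intro Bochner_Integration.integral_cong) (auto simp: algebra_simps)
    finally show ?thesis .
  qed
  have flux: "norm x powr p * flux_density \<Omega> s u x y = (u x - l) * (indicator K y * \<rho> y)
      - (indicator K y * (u y - l) * (\<rho> y - 1) + indicator K y * (u y - l))" for y
  proof -
    have "norm x powr p * flux_density \<Omega> s u x y = indicator K y * ((u x - u y) * \<rho> y)"
      by (simp add: flux_density_def \<rho>_def K_def p_def powr_divide)
    then show ?thesis by (simp add: algebra_simps)
  qed
  have K\<rho>_int: "integrable lborel (\<lambda>y. indicator K y * \<rho> y)"
    using Bochner_Integration.integrable_add[OF \<rho>_int K_int] by (simp add: algebra_simps)
  have "norm x powr p * (\<integral>y. flux_density \<Omega> s u x y \<partial>lborel)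
      = (\<integral>y. norm x powr p * flux_density \<Omega> s u x y \<partial>lborel)" by simp
  also have "\<dots> = (u x - l) * (\<integral>y. indicator K y * \<rho> y \<partial>lborel)
      - (\<integral>y. indicator K y * (u y - l) * (\<rho> y - 1) \<partial>lborel)"
    unfolding flux using K\<rho>_int dev dev\<rho> dev0 by simp
  finally have eq: "(u x - l) * (\<integral>y. indicator K y * \<rho> y \<partial>lborel) =
      norm x powr p * (\<integral>y. flux_density \<Omega> s u x y \<partial>lborel)
      + (\<integral>y. indicator K y * (u y - l) * (\<rho> y - 1) \<partial>lborel)" by simp
  have err: "\<bar>\<integral>y. indicator K y * (u y - l) * (\<rho> y - 1) \<partial>lborel\<bar>
      \<le> \<epsilon> * (\<integral>y. indicator K y * \<bar>u y - l\<bar> \<partial>lborel)"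
  proof -
    have abs_int: "integrable lborel (\<lambda>y. indicator K y * \<bar>u y - l\<bar>)"
      using integrable_abs[OF dev] by (simp add: abs_mult)
    have "\<bar>\<integral>y. indicator K y * (u y - l) * (\<rho> y - 1) \<partial>lborel\<bar>
        \<le> (\<integral>y. \<bar>indicator K y * (u y - l) * (\<rho> y - 1)\<bar> \<partial>lborel)"
      by (rule integral_abs_bound)
    also have "\<dots> \<le> (\<integral>y. \<epsilon> * (indicator K y * \<bar>u y - l\<bar>) \<partial>lborel)"
    proof (intro integral_mono integrable_abs dev\<rho>)
      fix y show "\<bar>indicator K y * (u y - l) * (\<rho> y - 1)\<bar> \<le> \<epsilon> * (indicator K y * \<bar>u y - l\<bar>)"
        using mult_left_mono[OF \<rho>[of y], of "\<bar>u y - l\<bar>"] by (auto simp: indicator_def abs_mult mult.commute)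
    qed (use abs_int in simp)
    finally show ?thesis by simp
  qed
  have "\<bar>u x - l\<bar> * (m / 2) \<le> \<bar>u x - l\<bar> * (\<integral>y. indicator K y * \<rho> y \<partial>lborel)"
    using \<rho>_lower by (intro mult_left_mono) auto
  also have "\<dots> = \<bar>(u x - l) * (\<integral>y. indicator K y * \<rho> y \<partial>lborel)\<bar>"
    using \<rho>_lower K(2) by (simp add: abs_mult)
  also have "\<dots> \<le> norm x powr p * \<bar>\<integral>y. flux_density \<Omega> s u x y \<partial>lborel\<bar>
      + \<epsilon> * (\<integral>y. indicator K y * \<bar>u y - l\<bar> \<partial>lborel)"
    unfolding eq using err
    by (intro order_trans[OF abs_triangle_ineq] add_mono) (auto simp: abs_mult)
  finally show ?thesis using K(2) by (simp add: field_simps)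
qed

lemma ess_lim_at_infinityD:
  assumes "ess_lim_at_infinity w l" "0 < \<epsilon>"
  obtains r where "AE x in lebesgue. r < norm x \<longrightarrow> \<bar>w x - l\<bar> \<le> \<epsilon>"
proof -
  have "\<forall>\<^sub>F r in at_top. esssup (lebesgue_on {x. norm x > r}) (\<lambda>x. ereal \<bar>w x - l\<bar>) < ereal \<epsilon>"
    using assms unfolding ess_lim_at_infinity_def by (intro order_tendstoD) auto
  then obtain r where r: "esssup (lebesgue_on {x. norm x > r}) (\<lambda>x. ereal \<bar>w x - l\<bar>) < ereal \<epsilon>"
    by (auto dest: eventually_happens)
  have "AE x in lebesgue_on {x. norm x > r}. \<bar>w x - l\<bar> \<le> \<epsilon>"
    using esssup_AE[of "\<lambda>x. ereal \<bar>w x - l\<bar>" "lebesgue_on {x. norm x > r}"]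
    by eventually_elim (use r in \<open>meson ereal_less_eq(3) le_less_trans less_imp_le\<close>)
  moreover have "{x::'a. norm x > r} \<in> sets lebesgue"
    by (intro sets_completionI_sets) (simp add: borel_open open_Collect_less)
  ultimately show thesis
    using that[of r] by (subst (asm) AE_restrict_space_iff) auto
qed

text \<open>The essential supremum of a nonnegative function is nonnegative only over a set of positive measure
(over a null set it is \<open>-\<infinity>\<close>), and the complement of a ball has positive measure.\<close>
lemma ess_lim_at_infinityI:
  fixes w :: "'a::euclidean_space \<Rightarrow> real"
  assumes w: "w \<in> borel_measurable lebesgue"
    and lim: "\<And>\<epsilon>. 0 < \<epsilon> \<Longrightarrow> \<exists>r. AE x in lebesgue. r < norm x \<longrightarrow> \<bar>w x - l\<bar> \<le> \<epsilon>"
  shows "ess_lim_at_infinity w l"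
  unfolding ess_lim_at_infinity_def
proof (rule order_tendstoI)
  have op: "open {x::'a. norm x > r}" for r by (intro open_Collect_less continuous_intros)
  have sets: "{x::'a. norm x > r} \<in> sets lebesgue" for r
    using op[of r] by (intro sets_completionI_sets) simp
  have meas: "(\<lambda>x. ereal \<bar>w x - l\<bar>) \<in> borel_measurable (lebesgue_on {x. norm x > r})" for r
  proof -
    have "w \<in> borel_measurable (lebesgue_on {x. norm x > r})" using w by (rule measurable_restrict_space1)
    then show ?thesis by measurable
  qed
  fix a :: ereal
  show "\<forall>\<^sub>F r in at_top. a < esssup (lebesgue_on {x. norm x > r}) (\<lambda>x. ereal \<bar>w x - l\<bar>)" if "a < 0"
  proof (intro always_eventually allI)
    fix r :: real
    obtain x :: 'a where "norm x = \<bar>r\<bar> + 1" using vector_choose_size[of "\<bar>r\<bar> + 1"] by auto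
    then have "{x::'a. norm x > r} \<noteq> {}" by (auto intro!: exI[of _ x])
    then have "{x::'a. norm x > r} \<notin> null_sets lebesgue"
      using open_not_negligible[OF op] by (simp add: negligible_iff_null_sets)
    then have "emeasure lebesgue {x::'a. norm x > r} \<noteq> 0" using sets by auto
    then have "esssup (lebesgue_on {x::'a. norm x > r}) (\<lambda>x. 0 :: ereal) = 0"
      using sets[of r] by (intro esssup_const) (simp add: emeasure_restrict_space space_restrict_space)
    moreover have "esssup (lebesgue_on {x::'a. norm x > r}) (\<lambda>x. 0 :: ereal)
        \<le> esssup (lebesgue_on {x. norm x > r}) (\<lambda>x. ereal \<bar>w x - l\<bar>)"
      by (intro esssup_mono) auto
    ultimately show "a < esssup (lebesgue_on {x. norm x > r}) (\<lambda>x. ereal \<bar>w x - l\<bar>)"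
      using that by simp
  qed
  show "\<forall>\<^sub>F r in at_top. esssup (lebesgue_on {x. norm x > r}) (\<lambda>x. ereal \<bar>w x - l\<bar>) < a" if a: "0 < a"
  proof -
    obtain \<epsilon> where \<epsilon>: "0 < ereal \<epsilon>" "ereal \<epsilon> < a"
      using ereal_dense2[OF a] by auto
    then obtain r0 where r0: "AE x in lebesgue. r0 < norm x \<longrightarrow> \<bar>w x - l\<bar> \<le> \<epsilon>"
      using lim[of \<epsilon>] by auto
    have "esssup (lebesgue_on {x. norm x > r}) (\<lambda>x. ereal \<bar>w x - l\<bar>) < a" if "r0 \<le> r" for r
    proof -
      have "AE x in lebesgue_on {x. norm x > r}. ereal \<bar>w x - l\<bar> \<le> ereal \<epsilon>"
        using sets[of r]
        by (subst AE_restrict_space_iff) (use r0 that in \<open>auto elim!: eventually_mono\<close>)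
      then have "esssup (lebesgue_on {x. norm x > r}) (\<lambda>x. ereal \<bar>w x - l\<bar>) \<le> ereal \<epsilon>"
        using meas by (intro esssup_I)
      then show ?thesis using \<epsilon>(2) by simp
    qed
    then show ?thesis using eventually_ge_at_top[of r0] by (rule eventually_mono[rotated])
  qed
qed

text \<open>Constant functions are admissible and have no interaction with any function.\<close>
lemma weak_solution_integral:
  fixes \<Omega> :: "'a::euclidean_space set"
  assumes s: "0 < s" "s < 1" and \<Omega>: "open \<Omega>" "bounded \<Omega>"
    and u: "weak_solution \<Omega> s \<alpha> f g u"
  shows "\<alpha> * (\<integral>x. u x \<partial>lebesgue_on \<Omega>) = (\<integral>x. f x \<partial>lebesgue_on \<Omega>) + (\<integral>x. g x \<partial>lebesgue_on (exterior \<Omega>))"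
proof -
  have "X_inner \<Omega> s u (\<lambda>x. 1) = 0"
    by (simp add: X_inner_eq L2_inner_def diff_quot_def case_prod_beta')
  moreover have "X_inner \<Omega> s u (\<lambda>x. 1) + \<alpha> * L2_inner \<Omega> u (\<lambda>x. 1)
      = L2_inner \<Omega> f (\<lambda>x. 1) + L2_inner (exterior \<Omega>) g (\<lambda>x. 1)"
    using u constant_in_V_space[OF s \<Omega>] by (simp add: weak_solution_def)
  ultimately show ?thesis by (simp add: L2_inner_def)
qed

text \<open>In the exterior equation, \<open>norm x powr p * g x\<close> tends to 0 by assumption and the kernel ratio tends
to 1, so \<open>u\<close> tends to its mean over the closure of \<open>\<Omega>\<close>, which is the mean over \<open>\<Omega>\<close> as the frontier
is a null set. Each of the two error terms is made at most \<open>\<epsilon> / 2\<close>, after the factor \<open>2 / m\<close>.\<close>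
lemma weak_solution_limit:
  fixes \<Omega> :: "'a::euclidean_space set" and f g u :: "'a \<Rightarrow> real"
  assumes s: "0 < s" "s < 1" and \<alpha>: "0 < \<alpha>" and \<Omega>: "open \<Omega>" "bounded \<Omega>" "\<Omega> \<noteq> {}"
    and frontier: "negligible (frontier \<Omega>)"
    and g: "g \<in> L2s_dual (exterior \<Omega>) s"
    and g0: "ess_lim_at_infinity (\<lambda>x. g x * norm x powr (real DIM('a) + 2 * s)) 0"
    and u: "weak_solution \<Omega> s \<alpha> f g u"
  shows "ess_lim_at_infinity u (1 / measure lebesgue \<Omega> * (\<integral>x. u x \<partial>lebesgue_on \<Omega>))"
proof -
  define p where "p = real DIM('a) + 2 * s"
  define c where "c = frac_const DIM('a) s"
  define K where "K = closure \<Omega>"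
  define m where "m = measure lborel K"
  have c: "0 < c" unfolding c_def by (rule frac_const_pos[OF s])
  have \<Omega>L: "\<Omega> \<inter> space lebesgue \<in> sets lebesgue" using \<Omega>(1) by simp
  have Kb: "K \<in> sets borel" by (simp add: K_def)
  have uV: "u \<in> V_space \<Omega> s" using u by (simp add: weak_solution_def)
  then have um: "u \<in> borel_measurable lebesgue" by (simp add: V_space_def)
  then obtain w where w: "w \<in> borel_measurable borel" "AE x in lebesgue. u x = w x"
    by (rule borel_representative)
  have w_sol: "weak_solution \<Omega> s \<alpha> f g w"
  proof (rule weak_solution_cong_AE[OF s _ u])
    show "w \<in> borel_measurable lebesgue" using w(1) by (intro measurable_completion) simp
    show "AE x in lebesgue. w x = u x" using w(2) by eventually_elim simp
  qed (use \<Omega>L in simp)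
  have ae_K: "AE x in lebesgue. x \<in> K \<longleftrightarrow> x \<in> \<Omega>"
  proof -
    have "AE x in lebesgue. x \<notin> frontier \<Omega>"
      using frontier by (intro AE_not_in) (simp add: negligible_iff_null_sets)
    then show ?thesis
      by eventually_elim (use \<Omega>(1) closure_subset[of \<Omega>] in \<open>auto simp: K_def frontier_def interior_open\<close>)
  qed
  have m_eq: "measure lebesgue \<Omega> = m"
  proof -
    have "emeasure lebesgue \<Omega> = emeasure lebesgue K"
      using ae_K \<Omega>L Kb by (intro emeasure_eq_AE) auto
    then show ?thesis using Kb by (simp add: measure_def m_def)
  qed
  have m: "0 < m"
  proof -
    have "emeasure lborel K < \<infinity>"
      using emeasure_bounded_finite[of K] \<Omega>(2) by (simp add: K_def bounded_closure)
    moreover have "emeasure lborel K \<noteq> 0"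
    proof
      assume "emeasure lborel K = 0"
      then have "negligible K"
        using Kb unfolding negligible_iff_null_sets by (intro null_sets_completionI) (auto simp: null_sets_def)
      then have "negligible \<Omega>" using closure_subset[of \<Omega>] by (auto simp: K_def intro: negligible_subset)
      then show False using open_not_negligible[OF \<Omega>(1,3)] by simp
    qed
    ultimately show ?thesis by (simp add: m_def measure_def enn2real_positive_iff less_top zero_less_iff_neq_zero)
  qed
  have u_int: "integrable lebesgue (\<lambda>x. indicator \<Omega> x *\<^sub>R u x)"
    using integrable_mult_L2[of u \<Omega> "\<lambda>x. 1"] uV constant_in_V_space[OF s \<Omega>(1,2), of 1]
    unfolding integrable_restrict_space[OF \<Omega>L, symmetric] by (simp add: V_space_iff[OF s])
  have ae_w: "AE x in lebesgue. indicator \<Omega> x *\<^sub>R u x = indicator K x * w x"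
    using ae_K w(2) by eventually_elim (auto simp: indicator_def)
  have wb: "(\<lambda>x. indicator K x * w x) \<in> borel_measurable lborel" using w(1) Kb by simp
  have wl: "(\<lambda>x. indicator K x * w x) \<in> borel_measurable lebesgue" using wb by (rule measurable_completion)
  have w_int: "integrable lborel (\<lambda>x. indicator K x * w x)"
    using integrable_cong_AE[OF borel_measurable_integrable[OF u_int] wl ae_w] u_int wb
    by (simp add: integrable_completion)
  define l where "l = (\<integral>x. indicator K x * w x \<partial>lborel) / m"
  have l_eq: "1 / measure lebesgue \<Omega> * (\<integral>x. u x \<partial>lebesgue_on \<Omega>) = l"
  proof -
    have "(\<integral>x. u x \<partial>lebesgue_on \<Omega>) = (\<integral>x. indicator K x * w x \<partial>lebesgue)"
      unfolding integral_restrict_space[OF \<Omega>L]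
      by (rule integral_cong_AE[OF borel_measurable_integrable[OF u_int] wl ae_w])
    also have "\<dots> = (\<integral>x. indicator K x * w x \<partial>lborel)" using wb by (rule integral_completion)
    finally show ?thesis by (simp add: m_eq l_def)
  qed
  obtain R0 where R0: "closure \<Omega> \<subseteq> ball 0 R0"
    using bounded_subset_ballD[OF bounded_closure[OF \<Omega>(2)], of 0] by blast
  have R: "closure \<Omega> \<subseteq> cball 0 \<bar>R0\<bar>"
    by (rule subset_trans[OF R0]) auto
  define S where "S = (\<integral>y. indicator K y * \<bar>w y - l\<bar> \<partial>lborel)"
  have S: "0 \<le> S" unfolding S_def by (intro integral_nonneg_AE) auto
  note eq = exterior_equation[OF s \<alpha> \<Omega> g w(1) w_sol R]
  show ?thesis
    unfolding l_eq
  proof (rule ess_lim_at_infinityI[OF um])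
    fix \<epsilon> :: real assume \<epsilon>: "0 < \<epsilon>"
    \<comment> \<open>At most \<open>1 / 2\<close>, as \<open>deviation_from_mean_le\<close> requires; \<open>S + 1\<close> is positive even if \<open>S = 0\<close>.\<close>
    define \<delta> where "\<delta> = min (1 / 2) (\<epsilon> * m / (4 * (S + 1)))"
    have \<delta>: "0 < \<delta>" "\<delta> \<le> 1 / 2"
      unfolding \<delta>_def using \<epsilon> m S by (simp, intro min.cobounded1)
    have \<delta>S: "\<delta> * S \<le> \<epsilon> * m / 4"
    proof -
      have "\<delta> * S \<le> \<epsilon> * m / (4 * (S + 1)) * (S + 1)"
        using \<epsilon> m S by (intro mult_mono) (auto simp: \<delta>_def)
      also have "\<dots> = \<epsilon> * m / 4" using S by (simp add: field_simps)
      finally show ?thesis .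
    qed
    obtain r1 where r1: "\<bar>R0\<bar> < r1" "\<And>x y :: 'a. r1 < norm x \<Longrightarrow> norm y \<le> \<bar>R0\<bar> \<Longrightarrow>
       \<bar>(norm x / norm (x - y)) powr p - 1\<bar> \<le> \<delta>"
      using kernel_ratio_tendsto_one[of "\<bar>R0\<bar>" \<delta> p, where 'a='a] \<delta>(1) by auto
    obtain r2 where r2: "AE x in lebesgue. r2 < norm x \<longrightarrow>
        \<bar>g x * norm x powr (real DIM('a) + 2 * s) - 0\<bar> \<le> \<epsilon> * c * m / 4"
      using ess_lim_at_infinityD[OF g0, of "\<epsilon> * c * m / 4"] \<epsilon> c m by auto
    define r where "r = max (\<bar>R0\<bar> + 1) (max r1 r2)"
    have "AE x in lebesgue. r < norm x \<longrightarrow> \<bar>u x - l\<bar> \<le> \<epsilon>"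
      using r2 eq w(2)
    proof eventually_elim
      case (elim x)
      show ?case
      proof
        assume "r < norm x"
        then have x: "\<bar>R0\<bar> + 1 < norm x" "r1 < norm x" "r2 < norm x" by (auto simp: r_def)
        let ?I = "\<integral>y. flux_density \<Omega> s w x y \<partial>lborel"
        have "norm x powr p * \<bar>?I\<bar> = \<bar>g x * norm x powr p\<bar> / c"
        proof -
          have "?I = g x / c" using elim(2) x(1) c by (simp add: c_def field_simps)
          then show ?thesis using c by (simp add: abs_mult abs_divide)
        qed
        also have "\<dots> \<le> (\<epsilon> * c * m / 4) / c"
          using elim(1) x(3) c by (intro divide_right_mono) (auto simp: p_def)
        also have "\<dots> = \<epsilon> * m / 4" using c by simp
        finally have I: "norm x powr p * \<bar>?I\<bar> \<le> \<epsilon> * m / 4" .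
        have "\<bar>w x - l\<bar> \<le> 2 / m * (norm x powr p * \<bar>?I\<bar> + \<delta> * S)"
          unfolding l_def S_def m_def p_def K_def
        proof (rule deviation_from_mean_le)
          show "\<bar>(norm x / norm (x - y)) powr (real DIM('a) + 2 * s) - 1\<bar> \<le> \<delta>" if "y \<in> closure \<Omega>" for y
            using r1(2)[OF x(2), of y] subsetD[OF R that] by (simp add: p_def)
        qed (use w(1) w_int \<Omega>(2) m \<delta>(2) in \<open>simp_all add: K_def m_def\<close>)
        also have "\<dots> \<le> 2 / m * (\<epsilon> * m / 4 + \<epsilon> * m / 4)"
          using I \<delta>S m by (intro mult_left_mono add_mono) auto
        also have "\<dots> = \<epsilon>" using m by (simp add: field_simps)
        finally show "\<bar>u x - l\<bar> \<le> \<epsilon>" using elim(3) by simp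
      qed
    qed
    then show "\<exists>r. AE x in lebesgue. r < norm x \<longrightarrow> \<bar>u x - l\<bar> \<le> \<epsilon>" by blast
  qed
qed

theorem corollary2p1:
  fixes \<Omega> :: "'a::euclidean_space set" and s \<alpha> :: real and f g :: "'a \<Rightarrow> real"
  assumes "bounded_lipschitz_domain \<Omega>"
    and "0 < s" and "s < 1" and "\<alpha> > 0"
    and "f \<in> L2_space \<Omega>"
    and "g \<in> L2s_dual (exterior \<Omega>) s"
    and "ess_lim_at_infinity (\<lambda>x. g x * norm x powr (real DIM('a) + 2 * s)) 0"
  shows "(\<exists>u. weak_solution \<Omega> s \<alpha> f g u \<and>
            (\<forall>w. weak_solution \<Omega> s \<alpha> f g w \<longrightarrow> (AE x in lebesgue. w x = u x))) \<and>
         (\<forall>u. weak_solution \<Omega> s \<alpha> f g u \<longrightarrow>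
            ess_lim_at_infinity u (1 / measure lebesgue \<Omega> * (\<integral>x. u x \<partial>lebesgue_on \<Omega>)) \<and>
            1 / measure lebesgue \<Omega> * (\<integral>x. u x \<partial>lebesgue_on \<Omega>) =
            1 / (\<alpha> * measure lebesgue \<Omega>) *
              ((\<integral>x. f x \<partial>lebesgue_on \<Omega>) + (\<integral>x. g x \<partial>lebesgue_on (exterior \<Omega>))))"
proof (intro conjI allI impI)
  have \<Omega>: "open \<Omega>" "bounded \<Omega>" "\<Omega> \<noteq> {}" and "lipschitz_boundary \<Omega>"
    using assms(1) by (auto simp: bounded_lipschitz_domain_def)
  show "\<exists>u. weak_solution \<Omega> s \<alpha> f g u \<and>
      (\<forall>w. weak_solution \<Omega> s \<alpha> f g w \<longrightarrow> (AE x in lebesgue. w x = u x))"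
    by (rule weak_solution_exists_unique[OF assms(2-4) \<Omega> assms(5,6)])
  fix u assume u: "weak_solution \<Omega> s \<alpha> f g u"
  have "negligible (frontier \<Omega>)"
    by (rule negligible_frontier_lipschitz_boundary) fact+
  then show "ess_lim_at_infinity u (1 / measure lebesgue \<Omega> * (\<integral>x. u x \<partial>lebesgue_on \<Omega>))"
    by (rule weak_solution_limit[OF assms(2-4) \<Omega> _ assms(6,7) u])
  show "1 / measure lebesgue \<Omega> * (\<integral>x. u x \<partial>lebesgue_on \<Omega>) = 1 / (\<alpha> * measure lebesgue \<Omega>) *
      ((\<integral>x. f x \<partial>lebesgue_on \<Omega>) + (\<integral>x. g x \<partial>lebesgue_on (exterior \<Omega>)))"
    unfolding weak_solution_integral[OF assms(2,3) \<Omega>(1,2) u, symmetric]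
    using assms(4) by simp
qed

end
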